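(* Let $X$ be a log-correlated field on $U\subset\mathbb{R}^d$ (see context) and let $K$ be a compact subset of $U$. (i) Let $d=2$ and assume in addition that $g\in C^2(U\times U)$. Then there is a constant $C>0$ depending only on $g$ and $K$ such that for all $N\ge2$, $q_1,\dots,q_N\in\{-1,1\}$ and $x_1,\dots,x_N\in K$, $$-\sum_{1\le j<k\le N}q_jq_k\,\mathbb{E}X(x_j)X(x_k)\le\frac12\sum_{j=1}^N\log\frac1{\frac12\min_{k\ne j}|x_j-x_k|}+CN.$$ (ii) Let $d\ge1$ be arbitrary (with no further assumptions on $g$). For the convolution approximations $X_\varepsilon$ of $X$ there is a constant $C>0$, independent of $\varepsilon>0$ and depending only on $g$ and $K$, such that for all $N\ge2$, $q_1,\dots,q_N\in\{-1,1\}$, $x_1,\dots,x_N\in K$ and $\varepsilon>0$, $$-\sum_{1\le j<k\le N}q_jq_k\,\mathbb{E}X_\varepsilon(x_j)X_\varepsilon(x_k)\le\frac12\sum_{j=1}^N\log\frac1{\frac12\min_{k\ne j}|x_j-x_k|}+CN^2.$$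
   Context: Setting: $d\ge1$, $U\subset\mathbb{R}^d$ is a bounded simply connected domain, and $C_X(x,y)=\log|x-y|^{-1}+g(x,y)$ for $x,y\in U$, where $g:U\times U\to\mathbb{R}$ belongs to $L^1(U\times U)\cap C(U\times U)$ and is bounded from above. $C_X$ is extended by $0$ outside $U\times U$ and is assumed to be a covariance kernel: symmetric and $\int\int C_X(x,y)f(x)\overline{f(y)}\,dx\,dy\ge0$ for all $f\in C_c^\infty(\mathbb{R}^d)$. The log-correlated field $X$ is the centered Gaussian random generalized function on $\mathbb{R}^d$ with covariance kernel $C_X$. In (i), $\mathbb{E}X(x)X(y)$ is notation for $C_X(x,y)$. Convolution approximations: fix once and for all $\eta\in C_c^\infty(\mathbb{R}^d)$ non-negative, radially symmetric, with $\int\eta=1$ and support in $B(0,1)$; $\eta_\varepsilon=\varepsilon^{-d}\eta(\cdot/\varepsilon)$ and $X_\varepsilon=(X*\eta_\varepsilon)\mathbf{1}_U$, so that for $x,y\in U$, $\mathbb{E}X_\varepsilon(x)X_\varepsilon(y)=\int\int\eta_\varepsilon(x-u)\eta_\varepsilon(y-v)C_X(u,v)\,du\,dv$. If two of the points $x_j$ coincide the right-hand sides are interpreted as $+\infty$ and the inequalities as trivially true. *)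

theory Defs
  imports "HOL-Probability.Probability"
begin

section \<open>Differentiability classes and test functions\<close>

text \<open>Directional derivatives along \<open>v\<^sub>1, \<dots>, v\<^sub>m\<close>, the head of the list being applied last.
  For lists over \<^const>\<open>Basis\<close> these are the iterated partial derivatives.\<close>

primrec iter_deriv ::
  "'a::euclidean_space list \<Rightarrow> ('a \<Rightarrow> 'b::real_normed_vector) \<Rightarrow> 'a \<Rightarrow> 'b" where
  "iter_deriv [] f = f"
| "iter_deriv (v # vs) f = (\<lambda>x. frechet_derivative (iter_deriv vs f) (at x) v)"

text \<open>The class \<open>C\<^sup>k(S)\<close>; meant for open \<open>S\<close> only, since derivatives are taken in the full space.
  The first conjunct is needed because \<^const>\<open>frechet_derivative\<close> is a total function.\<close>

definition Ck_on ::
  "nat \<Rightarrow> 'a::euclidean_space set \<Rightarrow> ('a \<Rightarrow> 'b::real_normed_vector) \<Rightarrow> bool" where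
  "Ck_on k S f \<longleftrightarrow>
     (\<forall>vs. set vs \<subseteq> Basis \<and> length vs < k \<longrightarrow> (\<forall>x\<in>S. iter_deriv vs f differentiable (at x))) \<and>
     (\<forall>vs. set vs \<subseteq> Basis \<and> length vs \<le> k \<longrightarrow> continuous_on S (iter_deriv vs f))"

definition supp :: "('a::topological_space \<Rightarrow> 'b::zero) \<Rightarrow> 'a set" where
  "supp f = closure {x. f x \<noteq> 0}"

text \<open>The space \<open>C\<^sub>c\<^sup>\<infinity>\<close> on the whole Euclidean space, with real or complex values.\<close>

definition test_function :: "('a::euclidean_space \<Rightarrow> 'b::real_normed_vector) \<Rightarrow> bool" where
  "test_function f \<longleftrightarrow> (\<forall>k. Ck_on k UNIV f) \<and> compact (supp f)"

text \<open>Generalized functions (distributions): linear functionals on real test functions, continuous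
  in the usual sense that on test functions supported in a fixed compact set they are bounded by
  finitely many of the seminorms \<open>sup |\<partial>\<^sup>\<alpha> f|\<close>. Values outside the test functions are irrelevant.\<close>

definition generalized_function :: "(('a::euclidean_space \<Rightarrow> real) \<Rightarrow> real) \<Rightarrow> bool" where
  "generalized_function u \<longleftrightarrow>
     (\<forall>f h a b. test_function f \<and> test_function h \<longrightarrow>
        u (\<lambda>x. a * f x + b * h x) = a * u f + b * u h) \<and>
     (\<forall>L. compact L \<longrightarrow> (\<exists>c m. \<forall>f B. test_function f \<and> supp f \<subseteq> L \<and>
        (\<forall>vs x. set vs \<subseteq> Basis \<and> length vs \<le> m \<longrightarrow> \<bar>iter_deriv vs f x\<bar> \<le> B) \<longrightarrow>
        \<bar>u f\<bar> \<le> c * B))"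

section \<open>Log-correlated kernels and fields\<close>

text \<open>The kernel \<open>C\<^sub>X\<close>, extended by zero. On the diagonal its value is arbitrary, because
  \<open>ln (1 / 0) = 0\<close>; the diagonal is a null set and is excluded in the inequalities.\<close>

definition log_kernel ::
  "'a::euclidean_space set \<Rightarrow> ('a \<times> 'a \<Rightarrow> real) \<Rightarrow> 'a \<Rightarrow> 'a \<Rightarrow> real" where
  "log_kernel U g x y = (if x \<in> U \<and> y \<in> U then ln (1 / norm (x - y)) + g (x, y) else 0)"

definition covariance_kernel :: "('a::euclidean_space \<Rightarrow> 'a \<Rightarrow> real) \<Rightarrow> bool" where
  "covariance_kernel C \<longleftrightarrow>
     (\<forall>x y. C x y = C y x) \<and>
     (\<forall>f :: 'a \<Rightarrow> complex. test_function f \<longrightarrow>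
        (\<integral>(x, y). complex_of_real (C x y) * f x * cnj (f y) \<partial>(lborel \<Otimes>\<^sub>M lborel)) \<in> \<real>\<^sub>\<ge>\<^sub>0)"

definition log_correlated_kernel ::
  "'a::euclidean_space set \<Rightarrow> ('a \<times> 'a \<Rightarrow> real) \<Rightarrow> bool" where
  "log_correlated_kernel U g \<longleftrightarrow>
     U \<noteq> {} \<and> open U \<and> connected U \<and> bounded U \<and> simply_connected U \<and>
     continuous_on (U \<times> U) g \<and>
     set_integrable (lborel \<Otimes>\<^sub>M lborel) (U \<times> U) g \<and>
     bdd_above (g ` (U \<times> U)) \<and>
     covariance_kernel (log_kernel U g)"

definition centered_gaussian :: "'w measure \<Rightarrow> ('w \<Rightarrow> real) \<Rightarrow> bool" where
  "centered_gaussian M Y \<longleftrightarrow> Y \<in> borel_measurable M \<and>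
     ((AE \<omega> in M. Y \<omega> = 0) \<or> (\<exists>\<sigma>>0. distributed M lborel Y (normal_density 0 \<sigma>)))"

text \<open>\<open>X f \<omega>\<close> is the pairing of the realization at \<open>\<omega>\<close> with the test function \<open>f\<close>. Joint
  Gaussianity follows from linearity, since every single \<open>X f\<close> is Gaussian.\<close>

definition log_correlated_field ::
  "'a::euclidean_space set \<Rightarrow> ('a \<times> 'a \<Rightarrow> real) \<Rightarrow> 'w measure \<Rightarrow> (('a \<Rightarrow> real) \<Rightarrow> 'w \<Rightarrow> real) \<Rightarrow> bool"
  where
  "log_correlated_field U g M X \<longleftrightarrow>
     prob_space M \<and>
     (AE \<omega> in M. generalized_function (\<lambda>f. X f \<omega>)) \<and>
     (\<forall>f. test_function f \<longrightarrow> centered_gaussian M (X f)) \<and>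
     (\<forall>f h. test_function f \<and> test_function h \<longrightarrow>
        (\<integral>\<omega>. X f \<omega> * X h \<omega> \<partial>M) =
        (\<integral>(x, y). log_kernel U g x y * f x * h y \<partial>(lborel \<Otimes>\<^sub>M lborel)))"

section \<open>Convolution approximations\<close>

definition mollifier :: "('a::euclidean_space \<Rightarrow> real) \<Rightarrow> bool" where
  "mollifier \<eta> \<longleftrightarrow>
     test_function \<eta> \<and> (\<forall>x. 0 \<le> \<eta> x) \<and> (\<forall>x y. norm x = norm y \<longrightarrow> \<eta> x = \<eta> y) \<and>
     (\<integral>x. \<eta> x \<partial>lborel) = 1 \<and> supp \<eta> \<subseteq> ball 0 1"

definition scaled :: "('a::euclidean_space \<Rightarrow> real) \<Rightarrow> real \<Rightarrow> 'a \<Rightarrow> real" where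
  "scaled \<eta> \<epsilon> x = \<eta> (x /\<^sub>R \<epsilon>) / \<epsilon> ^ DIM('a)"

text \<open>\<open>X\<^sub>\<epsilon> = (X * \<eta>\<^sub>\<epsilon>) 1\<^sub>U\<close>; the convolution of a generalized function with a test function
  \<open>\<phi>\<close> is \<open>x \<mapsto> X (\<phi> (x - \<cdot>))\<close>.\<close>

definition conv_approx ::
  "'a::euclidean_space set \<Rightarrow> ('a \<Rightarrow> real) \<Rightarrow> (('a \<Rightarrow> real) \<Rightarrow> 'w \<Rightarrow> real) \<Rightarrow> real \<Rightarrow> 'a \<Rightarrow> 'w \<Rightarrow> real"
  where
  "conv_approx U \<eta> X \<epsilon> x \<omega> = X (\<lambda>y. scaled \<eta> \<epsilon> (x - y)) \<omega> * indicator U x"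

section \<open>The two sides of the inequalities\<close>

definition pair_sum :: "nat \<Rightarrow> (nat \<Rightarrow> real) \<Rightarrow> (nat \<Rightarrow> nat \<Rightarrow> real) \<Rightarrow> real" where
  "pair_sum N q c = (\<Sum>(j, k) \<in> {(j, k). 1 \<le> j \<and> j < k \<and> k \<le> N}. q j * q k * c j k)"

definition nn_log_sum :: "nat \<Rightarrow> (nat \<Rightarrow> 'a::metric_space) \<Rightarrow> real" where
  "nn_log_sum N x =
     (\<Sum>j = 1..N. ln (1 / (1/2 * Min ((\<lambda>k. dist (x j) (x k)) ` ({1..N} - {j})))))"

text \<open>Admissible charges and points. Points are required to be distinct: if two of them coincide,
  the right-hand sides are \<open>+\<infinity>\<close> by convention and there is nothing to assert.\<close>

definition configuration ::
  "'a set \<Rightarrow> nat \<Rightarrow> (nat \<Rightarrow> real) \<Rightarrow> (nat \<Rightarrow> 'a) \<Rightarrow> bool" where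
  "configuration K N q x \<longleftrightarrow>
     2 \<le> N \<and> (\<forall>j\<in>{1..N}. q j \<in> {-1, 1}) \<and> (\<forall>j\<in>{1..N}. x j \<in> K) \<and> inj_on x {1..N}"

end

theory Submission
  imports Defs
begin

text \<open>Both inequalities are instances of Onsager's argument from electrostatics. Replace each point
  \<open>x j\<close> by a unit charge smeared radially over a ball of radius \<open>a j\<close>. Since the kernel is positive
  definite, the energy of the smeared configuration with signs \<open>q j\<close> is non-negative, so minus the
  sum of the interactions of pairs is at most half the sum of the self-energies (\<open>neg_pair_sum_le\<close>).
  The self-energy of a charge smeared at scale \<open>a\<close> is \<open>ln (1/a) + O(1)\<close>, and taking \<open>a j\<close>
  proportional to the distance from \<open>x j\<close> to its nearest neighbour gives the right-hand sides of the
  inequalities. It remains to compare the interaction of smeared charges with the interaction that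
  the statement is about.

  For the kernel itself in the plane, the logarithm is harmonic, hence its average over two
  disjoint discs equals its value at the centres (\<open>log_mean_value_pair\<close>). The discs are disjoint
  because the radii are at most half the nearest neighbour distances. So only \<open>g\<close> contributes to the
  error, and as the averages are symmetric and \<open>g\<close> is twice continuously differentiable, this error
  is \<open>O((a j)\<^sup>2 + (a k)\<^sup>2)\<close> (\<open>cov_near_kernel\<close>). The sum over all pairs is \<open>O(N)\<close> times the sum of
  the \<open>(a j)\<^sup>2\<close>, and the latter is bounded since the discs are disjoint and lie in a bounded set.

  For the convolution approximations in arbitrary dimension, there is no exact cancellation, but
  the interaction of charges smeared at scales \<open>a\<close> and \<open>b\<close> around \<open>x\<close> and \<open>y\<close> is always
  \<open>- ln (max (dist x y) (max a b)) + O(1)\<close> (\<open>cov_estimate\<close>). If \<open>a j\<close> is the maximum of \<open>\<epsilon>\<close> and a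
  small multiple of the nearest neighbour distance, then the interactions at scales \<open>a j\<close>, \<open>a k\<close> and
  at scale \<open>\<epsilon>\<close> agree up to \<open>O(1)\<close> for each pair, which is the error \<open>O(N\<^sup>2)\<close>. This needs \<open>\<epsilon>\<close> small
  enough for the balls to stay in the domain; for larger \<open>\<epsilon>\<close> all covariances are bounded, because
  the kernel is integrable. The covariance of the field enters only through the kernel, so
  positivity can be used with several scales at once.\<close>

section \<open>Smooth functions and test functions\<close>

definition smooth :: "('a::euclidean_space \<Rightarrow> 'b::real_normed_vector) \<Rightarrow> bool" where
  "smooth f \<longleftrightarrow> (\<forall>vs x. set vs \<subseteq> Basis \<longrightarrow> iter_deriv vs f differentiable (at x))"

lemma test_function_iff_smooth: "test_function f \<longleftrightarrow> smooth f \<and> compact (supp f)"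
proof
  assume f: "test_function f"
  have "iter_deriv vs f differentiable (at x)" if "set vs \<subseteq> Basis" for vs x
    using f that unfolding test_function_def Ck_on_def by (metis UNIV_I lessI)
  then show "smooth f \<and> compact (supp f)"
    using f by (auto simp: smooth_def test_function_def)
next
  assume "smooth f \<and> compact (supp f)"
  then show "test_function f"
    by (auto simp: smooth_def test_function_def Ck_on_def
        intro!: differentiable_imp_continuous_on differentiable_at_imp_differentiable_on)
qed

text \<open>Smoothness is coinductive: it suffices to find a family of everywhere differentiable functions
  that contains \<open>f\<close> and is stable under partial derivatives. This avoids explicit formulas for
  iterated derivatives in all closure properties below.\<close>

lemma smooth_coinduct:
  assumes "P f"
    and "\<And>f. P f \<Longrightarrow> \<exists>f'. (\<forall>x. (f has_derivative f' x) (at x)) \<and> (\<forall>v\<in>Basis. P (\<lambda>x. f' x v))"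
  shows "smooth f"
proof -
  have "P (iter_deriv vs f)" if "set vs \<subseteq> Basis" for vs
    using that
  proof (induction vs)
    case Nil
    then show ?case using assms(1) by simp
  next
    case (Cons v vs)
    then have "P (iter_deriv vs f)" "v \<in> Basis" by auto
    then obtain f' where f': "\<And>x. (iter_deriv vs f has_derivative f' x) (at x)" "P (\<lambda>x. f' x v)"
      using assms(2) by blast
    have "(\<lambda>x. frechet_derivative (iter_deriv vs f) (at x) v) = (\<lambda>x. f' x v)"
      using frechet_derivative_at[OF f'(1)] by (intro ext) metis
    with f'(2) show ?case by simp
  qed
  then show ?thesis
    using assms(2) unfolding smooth_def differentiable_def by blast
qed

lemma smooth_has_derivative:
  "smooth f \<Longrightarrow> (f has_derivative frechet_derivative f (at x)) (at x)"
  unfolding smooth_def using frechet_derivative_works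
  by (metis iter_deriv.simps(1) empty_set empty_subsetI)

lemma iter_deriv_append: "iter_deriv (vs @ ws) f = iter_deriv vs (iter_deriv ws f)"
  by (induction vs) simp_all

lemma smooth_deriv:
  assumes "smooth f" "v \<in> Basis"
  shows "smooth (\<lambda>x. frechet_derivative f (at x) v)"
proof -
  have "iter_deriv vs (\<lambda>x. frechet_derivative f (at x) v) = iter_deriv (vs @ [v]) f" for vs
    by (simp add: iter_deriv_append)
  then show ?thesis
    using assms by (simp add: smooth_def)
qed

lemma smooth_compose_affine:
  assumes "smooth f"
  shows "smooth (\<lambda>y. f (a + b *\<^sub>R y))"
proof (rule smooth_coinduct[where P="\<lambda>h. \<exists>c g. smooth g \<and> h = (\<lambda>y. c *\<^sub>R g (a + b *\<^sub>R y))"])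
  show "\<exists>c g. smooth g \<and> (\<lambda>y. f (a + b *\<^sub>R y)) = (\<lambda>y. c *\<^sub>R g (a + b *\<^sub>R y))"
    using assms by (intro exI[of _ 1] exI[of _ f]) auto
next
  fix h :: "'a \<Rightarrow> 'b"
  assume "\<exists>c g. smooth g \<and> h = (\<lambda>y. c *\<^sub>R g (a + b *\<^sub>R y))"
  then obtain c g where g: "smooth g" and h: "h = (\<lambda>y. c *\<^sub>R g (a + b *\<^sub>R y))" by blast
  let ?G = "\<lambda>x. frechet_derivative g (at (a + b *\<^sub>R x))"
  have lin: "linear (?G x)" for x
    using smooth_has_derivative[OF g] has_derivative_linear by blast
  have aff: "((\<lambda>y. a + b *\<^sub>R y) has_derivative (\<lambda>v. b *\<^sub>R v)) (at x)" for x
    by (auto intro!: derivative_eq_intros)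
  have "(h has_derivative (\<lambda>v. (c * b) *\<^sub>R ?G x v)) (at x)" for x
    unfolding h
    using has_derivative_scaleR_right[OF has_derivative_compose[OF aff smooth_has_derivative[OF g]], of c]
    by (simp add: linear_scale[OF lin])
  moreover have "\<exists>c' g'. smooth g' \<and> (\<lambda>x. (c * b) *\<^sub>R ?G x v) = (\<lambda>y. c' *\<^sub>R g' (a + b *\<^sub>R y))"
    if "v \<in> Basis" for v
    using smooth_deriv[OF g that]
    by (intro exI[of _ "c * b"] exI[of _ "\<lambda>y. frechet_derivative g (at y) v"]) auto
  ultimately show "\<exists>f'. (\<forall>x. (h has_derivative f' x) (at x)) \<and>
      (\<forall>v\<in>Basis. \<exists>c g. smooth g \<and> (\<lambda>x. f' x v) = (\<lambda>y. c *\<^sub>R g (a + b *\<^sub>R y)))"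
    by (intro exI[of _ "\<lambda>x v. (c * b) *\<^sub>R ?G x v"]) auto
qed

lemma smooth_bounded_linear_image:
  assumes L: "bounded_linear L" and "smooth f"
  shows "smooth (\<lambda>y. L (f y))"
proof (rule smooth_coinduct[where P="\<lambda>h. \<exists>g. smooth g \<and> h = (\<lambda>y. L (g y))"])
  show "\<exists>g. smooth g \<and> (\<lambda>y. L (f y)) = (\<lambda>y. L (g y))" using assms by blast
next
  fix h assume "\<exists>g. smooth g \<and> h = (\<lambda>y. L (g y))"
  then obtain g where g: "smooth g" and h: "h = (\<lambda>y. L (g y))" by blast
  have "(h has_derivative (\<lambda>v. L (frechet_derivative g (at x) v))) (at x)" for x
    unfolding h by (rule bounded_linear.has_derivative[OF L smooth_has_derivative[OF g]])
  then show "\<exists>f'. (\<forall>x. (h has_derivative f' x) (at x)) \<and>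
      (\<forall>v\<in>Basis. \<exists>g. smooth g \<and> (\<lambda>x. f' x v) = (\<lambda>y. L (g y)))"
    using smooth_deriv[OF g]
    by (intro exI[of _ "\<lambda>x v. L (frechet_derivative g (at x) v)"]) blast
qed

lemma smooth_sum:
  assumes "\<And>i. i \<in> I \<Longrightarrow> smooth (f i)"
  shows "smooth (\<lambda>y. \<Sum>i\<in>I. f i y)"
proof (rule smooth_coinduct[where P="\<lambda>h. \<exists>g. (\<forall>i\<in>I. smooth (g i)) \<and> h = (\<lambda>y. \<Sum>i\<in>I. g i y)"])
  show "\<exists>g. (\<forall>i\<in>I. smooth (g i)) \<and> (\<lambda>y. \<Sum>i\<in>I. f i y) = (\<lambda>y. \<Sum>i\<in>I. g i y)"
    using assms by blast
next
  fix h :: "'b \<Rightarrow> 'c" assume "\<exists>g. (\<forall>i\<in>I. smooth (g i)) \<and> h = (\<lambda>y. \<Sum>i\<in>I. g i y)"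
  then obtain g where g: "\<And>i. i \<in> I \<Longrightarrow> smooth (g i)" and h: "h = (\<lambda>y. \<Sum>i\<in>I. g i y)" by blast
  have "(h has_derivative (\<lambda>v. \<Sum>i\<in>I. frechet_derivative (g i) (at x) v)) (at x)" for x
    unfolding h using smooth_has_derivative[OF g] by (intro has_derivative_sum)
  moreover have "\<exists>g'. (\<forall>i\<in>I. smooth (g' i)) \<and>
      (\<lambda>x. \<Sum>i\<in>I. frechet_derivative (g i) (at x) v) = (\<lambda>y. \<Sum>i\<in>I. g' i y)" if "v \<in> Basis" for v
    using smooth_deriv[OF g that]
    by (intro exI[of _ "\<lambda>i x. frechet_derivative (g i) (at x) v"]) auto
  ultimately show "\<exists>f'. (\<forall>x. (h has_derivative f' x) (at x)) \<and>
      (\<forall>v\<in>Basis. \<exists>g. (\<forall>i\<in>I. smooth (g i)) \<and> (\<lambda>x. f' x v) = (\<lambda>y. \<Sum>i\<in>I. g i y))"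
    by (intro exI[of _ "\<lambda>x v. \<Sum>i\<in>I. frechet_derivative (g i) (at x) v"]) blast
qed

text \<open>Supports are closures, so a closed set containing all points of non-vanishing contains the
  support.\<close>

lemma compact_supp_if_subset:
  fixes f :: "'a::heine_borel \<Rightarrow> 'b::zero"
  assumes "compact L" "\<And>x. f x \<noteq> 0 \<Longrightarrow> x \<in> L"
  shows "compact (supp f)" "supp f \<subseteq> L"
proof -
  show *: "supp f \<subseteq> L"
    unfolding supp_def using assms by (intro closure_minimal) (auto intro: compact_imp_closed)
  show "compact (supp f)"
    using * assms(1) unfolding supp_def
    by (meson bounded_subset closed_closure compact_eq_bounded_closed)
qed

lemma mem_supp: "f x \<noteq> 0 \<Longrightarrow> x \<in> supp f"
  unfolding supp_def by (rule subsetD[OF closure_subset]) simp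

lemma test_function_bounded_linear_image:
  assumes L: "bounded_linear L" and f: "test_function f"
  shows "test_function (\<lambda>y. L (f y))"
  using f unfolding test_function_iff_smooth
  by (auto intro!: smooth_bounded_linear_image[OF L] compact_supp_if_subset(1)[of "supp f"] mem_supp
      simp: linear_0[OF bounded_linear.linear[OF L]])

lemma test_function_sum:
  assumes "finite I" "\<And>i. i \<in> I \<Longrightarrow> test_function (f i)"
  shows "test_function (\<lambda>y. \<Sum>i\<in>I. f i y)"
proof -
  have "compact (\<Union>i\<in>I. supp (f i))"
    using assms by (intro compact_UN) (auto simp: test_function_iff_smooth)
  moreover have "x \<in> (\<Union>i\<in>I. supp (f i))" if "(\<Sum>i\<in>I. f i x) \<noteq> 0" for x
    using that mem_supp[of _ x] by (meson UN_iff sum.neutral)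
  ultimately have "compact (supp (\<lambda>y. \<Sum>i\<in>I. f i y))"
    by (rule compact_supp_if_subset(1))
  with assms show ?thesis
    by (auto simp: test_function_iff_smooth intro!: smooth_sum)
qed

lemma test_function_compose_affine:
  assumes f: "test_function f" and b: "b \<noteq> 0"
  shows "test_function (\<lambda>y. f (a + b *\<^sub>R y))"
proof -
  have "compact ((\<lambda>z. (1 / b) *\<^sub>R (z - a)) ` supp f)"
    using f by (intro compact_continuous_image continuous_intros) (auto simp: test_function_iff_smooth)
  moreover have "y \<in> (\<lambda>z. (1 / b) *\<^sub>R (z - a)) ` supp f" if "f (a + b *\<^sub>R y) \<noteq> 0" for y
    using mem_supp[of f, OF that] b by (intro image_eqI[of _ _ "a + b *\<^sub>R y"]) auto
  ultimately have "compact (supp (\<lambda>y. f (a + b *\<^sub>R y)))"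
    by (rule compact_supp_if_subset(1))
  with f show ?thesis
    by (auto simp: test_function_iff_smooth intro!: smooth_compose_affine)
qed

lemma test_function_continuous: "test_function f \<Longrightarrow> continuous_on S f"
  by (meson continuous_at_imp_continuous_on has_derivative_continuous smooth_has_derivative
      test_function_iff_smooth)

lemma test_function_measurable [measurable_dest]:
  "test_function f \<Longrightarrow> f \<in> borel_measurable borel"
  by (intro borel_measurable_continuous_onI test_function_continuous)

lemma test_function_bounded:
  fixes f :: "'a::euclidean_space \<Rightarrow> real"
  assumes "test_function f"
  obtains B where "B > 0" "\<And>x. \<bar>f x\<bar> \<le> B"
proof -
  have "compact (f ` supp f)"
    using assms test_function_continuous
    by (intro compact_continuous_image) (auto simp: test_function_iff_smooth)
  then obtain b where b: "\<And>x. x \<in> supp f \<Longrightarrow> \<bar>f x\<bar> \<le> b"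
    using compact_imp_bounded bounded_iff by (metis imageI real_norm_def)
  have "\<bar>f x\<bar> \<le> max b 1" for x
    using b[of x] mem_supp[of f x] by fastforce
  then show ?thesis using that[of "max b 1"] by auto
qed

lemma test_function_integrable:
  fixes f :: "'a::euclidean_space \<Rightarrow> real"
  assumes "test_function f"
  shows "integrable lborel f"
proof -
  have "compact (supp f)" "continuous_on (supp f) f"
    using assms test_function_continuous by (auto simp: test_function_iff_smooth)
  then have "integrable lborel (\<lambda>x. indicator (supp f) x *\<^sub>R f x)"
    by (rule borel_integrable_compact)
  also have "(\<lambda>x. indicator (supp f) x *\<^sub>R f x) = f"
    using mem_supp[of f] by (auto simp: indicator_def fun_eq_iff)
  finally show ?thesis .
qed

section \<open>Existence of mollifiers\<close>

text \<open>The functions \<open>exp (- 1/t) / t\<^sup>n\<close>, extended by zero. The powers in the denominator are there because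
  derivatives of \<open>exp (- 1/t)\<close> produce them.\<close>

definition flat :: "nat \<Rightarrow> real \<Rightarrow> real" where
  "flat n t = (if 0 < t then exp (- (1 / t)) / t ^ n else 0)"

lemma power_le_fact_mult_exp:
  fixes x :: real
  assumes "0 \<le> x"
  shows "x ^ n \<le> fact n * exp x"
proof -
  have "(\<Sum>k\<in>{n}. x ^ k / fact k) \<le> (\<Sum>k. x ^ k / fact k)"
    using assms summable_exp[of x] by (intro sum_le_suminf) (auto simp: field_simps)
  then show ?thesis by (simp add: exp_def field_simps)
qed

text \<open>One term of the exponential series beats the denominator and leaves a factor \<open>t\<^sup>2\<close>; this is what
  makes the function differentiable at \<open>0\<close> with derivative \<open>0\<close>.\<close>

lemma flat_le_square: "0 \<le> flat n t \<and> flat n t \<le> fact (n + 2) * t\<^sup>2"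
proof (cases "0 < t")
  case True
  have "(1 / t) ^ (n + 2) \<le> fact (n + 2) * exp (1 / t)"
    using True by (intro power_le_fact_mult_exp) auto
  then have "exp (- (1 / t)) \<le> fact (n + 2) * t ^ (n + 2)"
    using True by (simp add: exp_minus power_one_over divide_le_eq pos_le_divide_eq
        field_simps del: fact_Suc power_Suc)
  then show ?thesis
    using True by (simp add: flat_def divide_le_eq power_add power2_eq_square ac_simps del: fact_Suc)
qed (auto simp: flat_def)

lemma flat_has_derivative:
  "(flat n has_real_derivative (flat (n + 2) t - real n * flat (n + 1) t)) (at t)"
proof -
  consider "t > 0" | "t < 0" | "t = 0" by linarith
  then show ?thesis
  proof cases
    case 1
    have "((\<lambda>t. exp (- (1 / t)) / t ^ n) has_real_derivative
        (flat (n + 2) t - real n * flat (n + 1) t)) (at t)"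
    proof (cases n)
      case 0
      then show ?thesis using 1
        by (auto intro!: derivative_eq_intros simp: flat_def power2_eq_square)
    next
      case (Suc m)
      then show ?thesis using 1
        by (auto intro!: derivative_eq_intros simp: flat_def field_simps power2_eq_square)
          (cases m; simp)
    qed
    then show ?thesis
      by (rule has_field_derivative_transform_within_open[where S="{0<..}"])
        (use 1 in \<open>auto simp: flat_def\<close>)
  next
    case 2
    have "((\<lambda>t. 0) has_real_derivative 0) (at t)" by simp
    then have "(flat n has_real_derivative 0) (at t)"
      by (rule has_field_derivative_transform_within_open[where S="{..<0}"])
        (use 2 in \<open>auto simp: flat_def\<close>)
    with 2 show ?thesis by (simp add: flat_def)
  next
    case 3
    have "(flat n has_real_derivative 0) (at 0)"
      unfolding has_field_derivative_def
    proof (rule has_derivativeI)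
      show "bounded_linear ((*) (0::real))" by (rule bounded_linear_mult_right)
      let ?c = "fact (n + 2) :: real"
      have "((\<lambda>y. ?c * \<bar>y\<bar>) \<longlongrightarrow> ?c * \<bar>0\<bar>) (at (0::real))"
        by (intro tendsto_intros)
      then have lim: "((\<lambda>y. ?c * \<bar>y\<bar>) \<longlongrightarrow> 0) (at (0::real))" by simp
      have "norm ((flat n y - flat n 0 - 0 * (y - 0)) /\<^sub>R norm (y - 0)) \<le> ?c * \<bar>y\<bar>" for y :: real
        using flat_le_square[of n y]
        by (cases "y = 0") (auto simp: flat_def[of _ 0] divide_simps power2_eq_square abs_if)
      then show "((\<lambda>y. (flat n y - flat n 0 - 0 * (y - 0)) /\<^sub>R norm (y - 0)) \<longlongrightarrow> 0) (at 0)"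
        by (intro tendsto_0_le[OF lim, of _ 1] always_eventually) auto
    qed
    with 3 show ?thesis by (simp add: flat_def)
  qed
qed

text \<open>An algebra of functions that contains the standard bump function and is closed under directional
  derivatives, which makes it a witness for \<open>smooth_coinduct\<close>.\<close>

inductive bump_algebra :: "('a::euclidean_space \<Rightarrow> real) \<Rightarrow> bool" where
  const: "bump_algebra (\<lambda>x. c)"
| inner: "bump_algebra (\<lambda>x. x \<bullet> v)"
| flat: "bump_algebra (\<lambda>x. flat n (r - x \<bullet> x))"
| add: "bump_algebra f \<Longrightarrow> bump_algebra h \<Longrightarrow> bump_algebra (\<lambda>x. f x + h x)"
| mult: "bump_algebra f \<Longrightarrow> bump_algebra h \<Longrightarrow> bump_algebra (\<lambda>x. f x * h x)"

lemma bump_algebra_has_derivative: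
  "bump_algebra f \<Longrightarrow> \<exists>f'. (\<forall>x. (f has_derivative f' x) (at x)) \<and> (\<forall>v. bump_algebra (\<lambda>x. f' x v))"
proof (induction rule: bump_algebra.induct)
  case (const c)
  then show ?case by (intro exI[of _ "\<lambda>x v. 0"]) (auto intro: bump_algebra.const)
next
  case (inner w)
  then show ?case
    by (intro exI[of _ "\<lambda>x v. v \<bullet> w"])
      (auto intro!: bump_algebra.const derivative_eq_intros)
next
  case (flat n r)
  let ?d = "\<lambda>x::'a. flat (n + 2) (r - x \<bullet> x) + (- real n) * flat (n + 1) (r - x \<bullet> x)"
  have "((\<lambda>x::'a. flat n (r - x \<bullet> x)) has_derivative (\<lambda>v. ?d x * (- 2 * (x \<bullet> v)))) (at x)" for x
  proof -
    have 1: "((\<lambda>x. r - x \<bullet> x) has_derivative (\<lambda>v. - 2 * (x \<bullet> v))) (at x)"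
      by (auto intro!: derivative_eq_intros simp: inner_commute)
    show ?thesis
      using has_derivative_compose[OF 1 flat_has_derivative[unfolded has_field_derivative_def]] by simp
  qed
  moreover have "bump_algebra (\<lambda>x. ?d x * (- 2 * (x \<bullet> v)))" for v
    by (intro bump_algebra.intros)
  ultimately show ?case by (intro exI[of _ "\<lambda>x v. ?d x * (- 2 * (x \<bullet> v))"]) blast
next
  case (add f h)
  then obtain f' h' where *: "\<And>x. (f has_derivative f' x) (at x)" "\<And>v. bump_algebra (\<lambda>x. f' x v)"
    "\<And>x. (h has_derivative h' x) (at x)" "\<And>v. bump_algebra (\<lambda>x. h' x v)" by blast
  then show ?case
    by (intro exI[of _ "\<lambda>x v. f' x v + h' x v"]) (auto intro!: has_derivative_add bump_algebra.add)
next
  case (mult f h)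
  then obtain f' h' where *: "\<And>x. (f has_derivative f' x) (at x)" "\<And>v. bump_algebra (\<lambda>x. f' x v)"
    "\<And>x. (h has_derivative h' x) (at x)" "\<And>v. bump_algebra (\<lambda>x. h' x v)" by blast
  then show ?case using mult(1,2)
    by (intro exI[of _ "\<lambda>x v. f x * h' x v + f' x v * h x"])
      (auto intro!: has_derivative_mult bump_algebra.add bump_algebra.mult)
qed

lemma smooth_bump_algebra: "bump_algebra f \<Longrightarrow> smooth f"
  by (rule smooth_coinduct[where P=bump_algebra]) (use bump_algebra_has_derivative in blast)+

text \<open>The statement about the kernel itself mentions no mollifier, so its proof has to supply one. The
  radius \<open>1/2\<close> keeps the closed support inside the open unit ball.\<close>

lemma mollifier_exists: "\<exists>\<eta> :: 'a::euclidean_space \<Rightarrow> real. mollifier \<eta>"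
proof -
  define b :: "'a \<Rightarrow> real" where "b x = flat 0 (1/4 - x \<bullet> x)" for x
  have b_pos: "b x > 0 \<longleftrightarrow> norm x < 1/2" and b_zero: "b x = 0 \<longleftrightarrow> norm x \<ge> 1/2" for x
  proof -
    have "1/4 - x \<bullet> x > 0 \<longleftrightarrow> norm x < 1/2"
      using abs_square_less_1[of "2 * norm x"] unfolding dot_square_norm
      by (auto simp: power_mult_distrib)
    then show "b x > 0 \<longleftrightarrow> norm x < 1/2" "b x = 0 \<longleftrightarrow> norm x \<ge> 1/2"
      by (auto simp: b_def flat_def)
  qed
  have b_ge: "b x \<ge> 0" for x by (simp add: b_def flat_def)
  have b_supp: "x \<in> cball 0 (1/2)" if "b x \<noteq> 0" for x
    using that b_zero[of x] by auto
  have "bump_algebra b"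
    unfolding b_def[abs_def] by (rule bump_algebra.flat)
  then have b_test: "test_function b"
    unfolding test_function_iff_smooth
    using compact_supp_if_subset(1)[of "cball 0 (1/2)" b] b_supp
    by (auto intro!: smooth_bump_algebra)
  then have [measurable]: "b \<in> borel_measurable borel" by measurable
  have b_int: "integrable lborel b"
    by (rule test_function_integrable[OF b_test])
  define I where "I = (\<integral>x. b x \<partial>lborel)"
  have "I > 0"
  proof -
    have "I \<noteq> 0"
    proof
      assume "I = 0"
      then have "AE x in lborel. b x = 0"
        using integral_nonneg_eq_0_iff_AE[OF b_int] b_ge by (auto simp: I_def)
      then have "AE x in lborel. x \<notin> ball (0::'a) (1/2)"
        by (rule AE_mp) (auto simp: b_zero)
      then have "emeasure lborel (ball (0::'a) (1/2)) = 0"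
        by (subst (asm) AE_iff_measurable[of "ball (0::'a) (1/2)"]) (auto simp del: emeasure_lborel_ball_finite)
      then have "measure lborel (ball (0::'a) (1/2)) = 0"
        by (simp add: measure_def)
      then show False by simp
    qed
    moreover have "I \<ge> 0" unfolding I_def using b_ge by (intro integral_nonneg_AE) auto
    ultimately show ?thesis by simp
  qed
  have "mollifier (\<lambda>x. (1 / I) * b x)"
    unfolding mollifier_def
  proof (intro conjI allI impI)
    show "test_function (\<lambda>x. (1 / I) * b x)"
      by (rule test_function_bounded_linear_image[OF bounded_linear_mult_right b_test])
    show "0 \<le> (1 / I) * b x" for x using \<open>I > 0\<close> b_ge by auto
    show "(1 / I) * b x = (1 / I) * b y" if "norm x = norm y" for x y
      using that by (simp add: b_def dot_square_norm)
    show "(\<integral>x. (1 / I) * b x \<partial>lborel) = 1" using \<open>I > 0\<close> by (simp add: I_def)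
    have "supp (\<lambda>x. (1 / I) * b x) \<subseteq> cball 0 (1/2)"
      by (rule compact_supp_if_subset(2)) (use b_supp in auto)
    then show "supp (\<lambda>x. (1 / I) * b x) \<subseteq> ball 0 1" by auto
  qed
  then show ?thesis by blast
qed

section \<open>Rescaled mollifiers\<close>

lemma mollifier_nonneg: "mollifier \<eta> \<Longrightarrow> 0 \<le> \<eta> x"
  unfolding mollifier_def by blast

lemma mollifier_test_function: "mollifier \<eta> \<Longrightarrow> test_function \<eta>"
  unfolding mollifier_def by blast

lemma mollifier_radial: "mollifier \<eta> \<Longrightarrow> norm x = norm y \<Longrightarrow> \<eta> x = \<eta> y"
  unfolding mollifier_def by blast

text \<open>The support is a compact subset of the open unit ball, hence stays a definite distance away from
  the sphere. This gap is what keeps logarithmic singularities on the boundary of a ball harmless.\<close>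

lemma mollifier_support:
  fixes \<eta> :: "'a::euclidean_space \<Rightarrow> real"
  assumes "mollifier \<eta>"
  obtains c where "0 < c" "c < 1" "\<And>a x u. 0 < a \<Longrightarrow> scaled \<eta> a (x - u) \<noteq> 0 \<Longrightarrow> dist x u \<le> c * a"
proof -
  have "compact (norm ` supp \<eta>)"
    using assms by (intro compact_continuous_image continuous_intros)
      (auto dest!: mollifier_test_function simp: test_function_def)
  have "\<exists>c<1. \<forall>x\<in>supp \<eta>. norm x \<le> c"
  proof (cases "supp \<eta> = {}")
    case True
    then show ?thesis by (intro exI[of _ 0]) auto
  next
    case False
    then obtain z where "z \<in> supp \<eta>" "\<And>x. x \<in> supp \<eta> \<Longrightarrow> norm x \<le> norm z"
      using compact_attains_sup[OF \<open>compact (norm ` supp \<eta>)\<close>] by auto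
    moreover have "supp \<eta> \<subseteq> ball 0 1" using assms unfolding mollifier_def by blast
    ultimately show ?thesis by (intro exI[of _ "norm z"]) auto
  qed
  then obtain c where c: "c < 1" "\<And>x. x \<in> supp \<eta> \<Longrightarrow> norm x \<le> c" by blast
  show ?thesis
  proof (rule that[of "max c (1/2)"])
    fix a :: real and x u :: 'a
    assume a: "0 < a" and nz: "scaled \<eta> a (x - u) \<noteq> 0"
    then have "(x - u) /\<^sub>R a \<in> supp \<eta>" by (auto simp: scaled_def intro: mem_supp)
    from c(2)[OF this] a have "norm (x - u) \<le> c * a"
      by (simp add: divide_inverse_commute[symmetric] pos_divide_le_eq)
    also have "\<dots> \<le> max c (1/2) * a" using a by (intro mult_right_mono) auto
    finally show "dist x u \<le> max c (1/2) * a" by (simp add: dist_norm)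
  qed (use c in auto)
qed

lemma scaled_outside:
  fixes \<eta> :: "'a::euclidean_space \<Rightarrow> real"
  assumes "mollifier \<eta>" "0 < a" "u \<notin> ball x a"
  shows "scaled \<eta> a (x - u) = 0"
proof (rule ccontr)
  assume nz: "scaled \<eta> a (x - u) \<noteq> 0"
  obtain c where c: "0 < c" "c < 1" "\<And>a x u. 0 < a \<Longrightarrow> scaled \<eta> a (x - u) \<noteq> 0 \<Longrightarrow> dist x u \<le> c * a"
    using mollifier_support[OF assms(1)] by metis
  then have "dist x u \<le> c * a" using nz assms(2) by blast
  moreover have "c * a < 1 * a" using c assms(2) by (intro mult_strict_right_mono) auto
  ultimately show False using assms(3) by simp
qed

lemma scaled_nonneg: "mollifier \<eta> \<Longrightarrow> 0 < a \<Longrightarrow> 0 \<le> scaled \<eta> a z"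
  by (simp add: mollifier_nonneg scaled_def)

lemma scaled_le:
  fixes \<eta> :: "'a::euclidean_space \<Rightarrow> real"
  shows "(\<And>x. \<bar>\<eta> x\<bar> \<le> B) \<Longrightarrow> 0 < a \<Longrightarrow> scaled \<eta> a z \<le> B / a ^ DIM('a)"
  by (auto simp: scaled_def abs_le_iff intro!: divide_right_mono)

lemma scaled_radial:
  assumes "mollifier \<eta>" "norm z = norm w"
  shows "scaled \<eta> a z = scaled \<eta> a w"
  using mollifier_radial[OF assms(1), of "z /\<^sub>R a" "w /\<^sub>R a"] assms(2) by (simp add: scaled_def)

lemma test_function_scaled:
  fixes \<eta> :: "'a::euclidean_space \<Rightarrow> real"
  assumes "mollifier \<eta>" "0 < a"
  shows "test_function (\<lambda>u. scaled \<eta> a (x - u))"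
proof -
  have "test_function (\<lambda>u. \<eta> ((1 / a) *\<^sub>R x + (- 1 / a) *\<^sub>R u))"
    using assms by (intro test_function_compose_affine mollifier_test_function) auto
  then have "test_function (\<lambda>u. (1 / a ^ DIM('a)) * \<eta> ((1 / a) *\<^sub>R x + (- 1 / a) *\<^sub>R u))"
    by (rule test_function_bounded_linear_image[OF bounded_linear_mult_right])
  then show ?thesis
    by (simp add: scaled_def scaleR_diff_right inverse_eq_divide)
qed

lemma measurable_scaled [measurable]:
  "mollifier \<eta> \<Longrightarrow> scaled \<eta> a \<in> borel_measurable borel"
proof -
  assume "mollifier \<eta>"
  then have [measurable]: "\<eta> \<in> borel_measurable borel"
    by (intro test_function_measurable mollifier_test_function)
  show ?thesis unfolding scaled_def[abs_def] by measurable
qed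

lemma has_bochner_integral_scaled:
  fixes \<eta> :: "'a::euclidean_space \<Rightarrow> real"
  assumes \<eta>: "mollifier \<eta>" and a: "0 < a"
  shows "has_bochner_integral lborel (\<lambda>u. scaled \<eta> a (x - u)) 1"
proof -
  note [measurable] = measurable_scaled[OF \<eta>]
  have "(\<integral>u. scaled \<eta> a (x - u) \<partial>lborel) = 
     (\<integral>u. scaled \<eta> a (x - u) \<partial>(density (distr lborel borel (\<lambda>z. x + (- a) *\<^sub>R z)) (\<lambda>_. ennreal \<bar>- a\<bar> ^ DIM('a))))"
    using a by (subst lborel_affine[of "- a" x]) (auto simp: ennreal_power)
  also have "\<dots> = (\<integral>u. scaled \<eta> a (x - u) \<partial>(density (distr lborel borel (\<lambda>z. x + (- a) *\<^sub>R z)) (\<lambda>_. ennreal (a ^ DIM('a)))))"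
    using a by (simp add: ennreal_power)
  also have "\<dots> = (\<integral>z. a ^ DIM('a) * scaled \<eta> a (a *\<^sub>R z) \<partial>lborel)"
    using a by (subst integral_density) (auto simp: integral_distr)
  also have "(\<lambda>z. a ^ DIM('a) * scaled \<eta> a (a *\<^sub>R z)) = \<eta>"
    using a by (auto simp: scaled_def)
  also have "(\<integral>z. \<eta> z \<partial>lborel) = 1"
    using \<eta> unfolding mollifier_def by blast
  finally show ?thesis
    using test_function_integrable[OF test_function_scaled[OF \<eta> a]]
    by (simp add: has_bochner_integral_iff)
qed

section \<open>The logarithmic pole\<close>

text \<open>The positive part of \<open>ln (1/t)\<close>: the only unbounded part of the kernel near the diagonal.\<close>

definition log_pole :: "real \<Rightarrow> real" where
  "log_pole t = max 0 (ln (1 / t))"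

lemma log_pole_nonneg [simp]: "0 \<le> log_pole t" by (simp add: log_pole_def)

lemma measurable_log_pole [measurable]: "log_pole \<in> borel_measurable borel"
  unfolding log_pole_def[abs_def] by measurable

text \<open>A layer-cake bound: \<open>log_pole t\<close> is at most the number of \<open>n\<close> with \<open>t < exp (- n)\<close>. It reduces
  integrals of the pole to volumes of balls.\<close>

lemma log_pole_le_suminf:
  assumes "0 \<le> t"
  shows "ennreal (log_pole t) \<le> (\<Sum>n. indicator {..<exp (- real n)} t)"
proof (cases "0 < t \<and> t < 1")
  case True
  define N where "N = nat \<lceil>ln (1 / t)\<rceil>"
  have "ln (1 / t) > 0" using True by simp
  then have "log_pole t \<le> real N" unfolding N_def log_pole_def by (simp add: of_nat_ceiling)
  have "t < exp (- real n)" if "n < N" for n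
  proof -
    have "int n < \<lceil>ln (1 / t)\<rceil>" using that by (simp add: N_def zless_nat_eq_int_zless)
    then have "real n < ln (1 / t)" by (simp add: less_ceiling_iff)
    then have "ln t < - real n" using True by (simp add: ln_div)
    then show ?thesis using True by (metis exp_less_cancel_iff exp_ln)
  qed
  then have "(\<Sum>n<N. indicator {..<exp (- real n)} t) = (\<Sum>n<N. (1::ennreal))"
    by (intro sum.cong) auto
  then have "ennreal (log_pole t) \<le> (\<Sum>n<N. indicator {..<exp (- real n)} t)"
    using \<open>log_pole t \<le> real N\<close> by (simp add: ennreal_of_nat_eq_real_of_nat ennreal_leI)
  also have "\<dots> \<le> (\<Sum>n. indicator {..<exp (- real n)} t)"
    by (intro sum_le_suminf) auto
  finally show ?thesis .
next
  case False
  then have "log_pole t = 0" using assms by (auto simp: log_pole_def)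
  then show ?thesis by simp
qed

text \<open>The sum of the geometric series with ratio \<open>exp (- 1)\<close> that bounds the total volume of the balls
  of radius \<open>exp (- n)\<close>; an upper bound for the integral of the pole at unit scale.\<close>

definition log_pole_mass :: "'a::euclidean_space itself \<Rightarrow> real" where
  "log_pole_mass _ = unit_ball_vol (DIM('a)) / (1 - exp (- 1))"

lemma log_pole_mass_nonneg [simp]: "0 \<le> log_pole_mass TYPE('a::euclidean_space)"
  by (auto simp: log_pole_mass_def intro!: divide_nonneg_nonneg)

lemma nn_integral_log_pole_le:
  fixes v :: "'a::euclidean_space"
  assumes a: "0 < a"
  shows "(\<integral>\<^sup>+u. ennreal (log_pole (norm (u - v) / a)) \<partial>lborel) \<le> ennreal (a ^ DIM('a) * log_pole_mass TYPE('a))"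
proof -
  let ?d = "DIM('a)" and ?V = "unit_ball_vol (DIM('a))"
  have V: "0 \<le> ?V" by simp
  have "(\<integral>\<^sup>+u. ennreal (log_pole (norm (u - v) / a)) \<partial>lborel)
      \<le> (\<integral>\<^sup>+u. (\<Sum>n. indicator (ball v (a * exp (- real n))) u) \<partial>lborel)"
  proof (rule nn_integral_mono)
    fix u :: 'a
    have "indicator {..<exp (- real n)} (norm (u - v) / a) = (indicator (ball v (a * exp (- real n))) u :: ennreal)" for n
      using a by (auto simp: indicator_def dist_norm norm_minus_commute field_simps)
    then show "ennreal (log_pole (norm (u - v) / a)) \<le> (\<Sum>n. indicator (ball v (a * exp (- real n))) u)"
      using log_pole_le_suminf[of "norm (u - v) / a"] a by simp
  qed
  also have "\<dots> = (\<Sum>n. emeasure lborel (ball v (a * exp (- real n))))"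
    by (subst nn_integral_suminf) (auto intro!: borel_measurable_indicator)
  also have "\<dots> = (\<Sum>n. ennreal (?V * (a * exp (- real n)) ^ ?d))"
    using a by (simp add: emeasure_ball)
  also have "\<dots> \<le> (\<Sum>n. ennreal (a ^ ?d * ?V * exp (- 1) ^ n))"
  proof (intro suminf_le ennreal_leI)
    fix n
    have "exp (- real n) ^ ?d \<le> exp (- real n) ^ 1"
      by (intro power_decreasing) (auto simp: Suc_le_eq)
    also have "exp (- real n) ^ 1 = exp (- 1) ^ n" by (simp flip: exp_of_nat_mult)
    finally have "?V * a ^ ?d * exp (- real n) ^ ?d \<le> ?V * a ^ ?d * exp (- 1) ^ n"
      using a V by (intro mult_left_mono) auto
    then show "?V * (a * exp (- real n)) ^ ?d \<le> a ^ ?d * ?V * exp (- 1) ^ n"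
      by (simp add: power_mult_distrib mult.commute mult.left_commute)
  qed auto
  also have "\<dots> = ennreal (a ^ ?d * ?V * (1 / (1 - exp (- 1))))"
    using a V by (intro suminf_ennreal_eq sums_mult geometric_sums) auto
  finally show ?thesis by (simp add: log_pole_mass_def)
qed

section \<open>Integrability of log-correlated kernels\<close>

lemma AE_offdiagonal: "AE p in lborel \<Otimes>\<^sub>M (lborel :: 'a::euclidean_space measure). fst p \<noteq> snd p"
proof (rule lborel_pair.AE_pair_measure)
  show "{x \<in> space (lborel \<Otimes>\<^sub>M lborel). fst x \<noteq> snd x} \<in> sets (lborel \<Otimes>\<^sub>M (lborel :: 'a measure))"
    by measurable
  show "AE x in lborel. AE y in lborel. fst (x, y) \<noteq> snd (x, y :: 'a)"
    using AE_lborel_singleton by (auto simp: eq_commute)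
qed

text \<open>On a bounded set the logarithm of the distance is bounded from above by its value at the
  diameter, so only the pole matters, and this is integrable in \<open>u\<close> uniformly in \<open>v\<close>.\<close>

lemma integrable_log_distance:
  fixes U :: "'a::euclidean_space set"
  assumes "open U" "bounded U"
  shows "integrable (lborel \<Otimes>\<^sub>M lborel) (\<lambda>(u, v). indicator (U \<times> U) (u, v) * ln (1 / norm (u - v)))"
proof -
  have [measurable]: "U \<in> sets borel" using assms by auto
  obtain D where D: "D > 0" "\<And>u v. u \<in> U \<Longrightarrow> v \<in> U \<Longrightarrow> dist u v \<le> D"
    using assms(2) unfolding bounded_two_points by (metis gt_ex less_eq_real_def order_less_le_trans linorder_not_le)
  let ?h = "\<lambda>(u, v). indicator (U \<times> U) (u, v) * (\<bar>ln D\<bar> + log_pole (norm (u - v) / 1) :: real)"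
  have fin: "emeasure lborel U < \<infinity>" using emeasure_bounded_finite[OF assms(2)] by simp
  have "integrable (lborel \<Otimes>\<^sub>M lborel) ?h"
  proof (rule integrableI_bounded)
    show "?h \<in> borel_measurable (lborel \<Otimes>\<^sub>M lborel)" by measurable
    have "(\<integral>\<^sup>+p. ennreal (norm (?h p)) \<partial>(lborel \<Otimes>\<^sub>M lborel))
        = (\<integral>\<^sup>+v. \<integral>\<^sup>+u. ennreal (norm (?h (u, v))) \<partial>lborel \<partial>lborel)"
      by (rule lborel_pair.nn_integral_snd[symmetric]) measurable
    also have "\<dots> \<le> (\<integral>\<^sup>+v. indicator U v * (ennreal \<bar>ln D\<bar> * emeasure lborel U + ennreal (log_pole_mass TYPE('a))) \<partial>lborel)"
    proof (rule nn_integral_mono)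
      fix v :: 'a
      have "(\<integral>\<^sup>+u. ennreal (norm (?h (u, v))) \<partial>lborel)
          \<le> (\<integral>\<^sup>+u. indicator U v * (ennreal \<bar>ln D\<bar> * indicator U u + ennreal (log_pole (norm (u - v) / 1))) \<partial>lborel)"
        by (intro nn_integral_mono) (auto simp: indicator_def)
      also have "\<dots> = indicator U v * (ennreal \<bar>ln D\<bar> * emeasure lborel U + (\<integral>\<^sup>+u. ennreal (log_pole (norm (u - v) / 1)) \<partial>lborel))"
        by (subst nn_integral_cmult) (auto simp: nn_integral_add nn_integral_cmult)
      also have "\<dots> \<le> indicator U v * (ennreal \<bar>ln D\<bar> * emeasure lborel U + ennreal (log_pole_mass TYPE('a)))"
        using nn_integral_log_pole_le[of 1 v] by (intro mult_left_mono add_left_mono) auto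
      finally show "(\<integral>\<^sup>+u. ennreal (norm (?h (u, v))) \<partial>lborel)
          \<le> indicator U v * (ennreal \<bar>ln D\<bar> * emeasure lborel U + ennreal (log_pole_mass TYPE('a)))" .
    qed
    also have "\<dots> = (ennreal \<bar>ln D\<bar> * emeasure lborel U + ennreal (log_pole_mass TYPE('a))) * emeasure lborel U"
      by (subst nn_integral_multc) (auto simp: mult.commute)
    also have "\<dots> < \<infinity>" using fin by (simp add: ennreal_mult_less_top)
    finally show "(\<integral>\<^sup>+p. ennreal (norm (?h p)) \<partial>(lborel \<Otimes>\<^sub>M lborel)) < \<infinity>" .
  qed
  then show ?thesis
  proof (rule Bochner_Integration.integrable_bound)
    show "AE p in lborel \<Otimes>\<^sub>M lborel. norm (case p of (u, v) \<Rightarrow> indicator (U \<times> U) (u, v) * ln (1 / norm (u - v))) \<le> norm (?h p)"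
    proof (intro always_eventually allI)
      fix p :: "'a \<times> 'a"
      obtain u v where p: "p = (u, v)" by fastforce
      have "\<bar>ln (1 / norm (u - v))\<bar> \<le> \<bar>ln D\<bar> + log_pole (norm (u - v))" if "u \<in> U" "v \<in> U"
      proof (cases "u = v")
        case False
        then have "0 < norm (u - v)" "norm (u - v) \<le> D" using D that by (auto simp: dist_norm)
        then have "ln (norm (u - v)) \<le> ln D" using D(1) by (subst ln_le_cancel_iff) auto
        then show ?thesis using \<open>0 < norm (u - v)\<close> unfolding log_pole_def by (simp add: ln_div)
      qed simp
      then show "norm (case p of (u, v) \<Rightarrow> indicator (U \<times> U) (u, v) * ln (1 / norm (u - v))) \<le> norm (?h p)"
        by (auto simp: p indicator_def)
    qed
  qed measurable
qed

lemma log_kernel_integrable: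
  fixes U :: "'a::euclidean_space set"
  assumes "log_correlated_kernel U g"
  shows "integrable (lborel \<Otimes>\<^sub>M lborel) (\<lambda>(u, v). log_kernel U g u v)"
proof -
  have "integrable (lborel \<Otimes>\<^sub>M lborel) (\<lambda>p. (case p of (u, v) \<Rightarrow> indicator (U \<times> U) (u, v) * ln (1 / norm (u - v))) + indicator (U \<times> U) p *\<^sub>R g p)"
    using assms integrable_log_distance[of U]
    by (intro Bochner_Integration.integrable_add) (auto simp: log_correlated_kernel_def set_integrable_def)
  also have "(\<lambda>p. (case p of (u, v) \<Rightarrow> indicator (U \<times> U) (u, v) * ln (1 / norm (u - v))) + indicator (U \<times> U) p *\<^sub>R g p)
      = (\<lambda>(u, v). log_kernel U g u v)"
    by (auto simp: log_kernel_def indicator_def fun_eq_iff)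
  finally show ?thesis .
qed

section \<open>Smeared covariances\<close>

definition weight :: "('a::euclidean_space \<Rightarrow> real) \<Rightarrow> real \<Rightarrow> 'a \<Rightarrow> real \<Rightarrow> 'a \<Rightarrow> 'a \<times> 'a \<Rightarrow> real" where
  "weight \<eta> a x b y p = scaled \<eta> a (x - fst p) * scaled \<eta> b (y - snd p)"

text \<open>The covariance of the averages of the field against the mollifier at scale \<open>a\<close> around \<open>x\<close> and at
  scale \<open>b\<close> around \<open>y\<close>. The two scales differ in general: the energy argument smears every
  point at its own scale.\<close>

definition cov ::
  "'a::euclidean_space set \<Rightarrow> ('a \<times> 'a \<Rightarrow> real) \<Rightarrow> ('a \<Rightarrow> real) \<Rightarrow> real \<Rightarrow> 'a \<Rightarrow> real \<Rightarrow> 'a \<Rightarrow> real" where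
  "cov U g \<eta> a x b y = (\<integral>p. log_kernel U g (fst p) (snd p) * weight \<eta> a x b y p \<partial>(lborel \<Otimes>\<^sub>M lborel))"

lemma weight_nonneg: "mollifier \<eta> \<Longrightarrow> 0 < a \<Longrightarrow> 0 < b \<Longrightarrow> 0 \<le> weight \<eta> a x b y p"
  by (simp add: weight_def scaled_nonneg)

lemma weight_outside:
  "mollifier \<eta> \<Longrightarrow> 0 < a \<Longrightarrow> 0 < b \<Longrightarrow> \<not> (fst p \<in> ball x a \<and> snd p \<in> ball y b) \<Longrightarrow> weight \<eta> a x b y p = 0"
  using scaled_outside[of \<eta> a "fst p" x] scaled_outside[of \<eta> b "snd p" y] by (auto simp: weight_def)

lemma measurable_weight [measurable]:
  "mollifier \<eta> \<Longrightarrow> weight \<eta> a x b y \<in> borel_measurable (lborel \<Otimes>\<^sub>M lborel)"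
proof -
  assume [measurable]: "mollifier \<eta>"
  show ?thesis unfolding weight_def[abs_def] by measurable
qed

lemma nn_integral_scaled:
  "mollifier \<eta> \<Longrightarrow> 0 < a \<Longrightarrow> (\<integral>\<^sup>+u. ennreal (scaled \<eta> a (x - u)) \<partial>lborel) = 1"
  using has_bochner_integral_scaled[of \<eta> a x] scaled_nonneg[of \<eta> a]
  by (subst nn_integral_eq_integral) (auto simp: has_bochner_integral_iff)

text \<open>Tonelli: a bound for the average in one variable alone, uniform in the other, bounds the average
  in both, because the remaining weight has mass one.\<close>

lemma integral_weight_le_if_fst:
  assumes \<eta>: "mollifier \<eta>" and ab: "0 < a" "0 < b" and "0 \<le> M"
    and [measurable]: "h \<in> borel_measurable (lborel \<Otimes>\<^sub>M lborel)" and h: "\<And>p. 0 \<le> h p"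
    and le: "\<And>v. (\<integral>\<^sup>+u. ennreal (scaled \<eta> a (x - u) * h (u, v)) \<partial>lborel) \<le> ennreal M"
  shows "integrable (lborel \<Otimes>\<^sub>M lborel) (\<lambda>p. h p * weight \<eta> a x b y p)"
    and "(\<integral>p. h p * weight \<eta> a x b y p \<partial>(lborel \<Otimes>\<^sub>M lborel)) \<le> M"
proof -
  note [measurable] = measurable_weight[OF \<eta>] measurable_scaled[OF \<eta>]
  let ?f = "\<lambda>p. h p * weight \<eta> a x b y p"
  have nonneg: "0 \<le> ?f p" for p using h weight_nonneg[OF \<eta> ab] by auto
  have "(\<integral>\<^sup>+p. ennreal (?f p) \<partial>(lborel \<Otimes>\<^sub>M lborel)) = (\<integral>\<^sup>+v. \<integral>\<^sup>+u. ennreal (?f (u, v)) \<partial>lborel \<partial>lborel)"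
    by (rule lborel_pair.nn_integral_snd[symmetric]) measurable
  also have "\<dots> \<le> (\<integral>\<^sup>+v. ennreal M * ennreal (scaled \<eta> b (y - v)) \<partial>lborel)"
  proof (rule nn_integral_mono)
    fix v
    have "(\<integral>\<^sup>+u. ennreal (?f (u, v)) \<partial>lborel)
        = (\<integral>\<^sup>+u. ennreal (scaled \<eta> b (y - v)) * ennreal (scaled \<eta> a (x - u) * h (u, v)) \<partial>lborel)"
      using scaled_nonneg[OF \<eta>] ab h
      by (intro nn_integral_cong) (auto simp: weight_def mult_ac simp flip: ennreal_mult)
    also have "\<dots> = ennreal (scaled \<eta> b (y - v)) * (\<integral>\<^sup>+u. ennreal (scaled \<eta> a (x - u) * h (u, v)) \<partial>lborel)"
      by (intro nn_integral_cmult) measurable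
    also have "\<dots> \<le> ennreal (scaled \<eta> b (y - v)) * ennreal M"
      using le by (intro mult_left_mono) auto
    finally show "(\<integral>\<^sup>+u. ennreal (?f (u, v)) \<partial>lborel) \<le> ennreal M * ennreal (scaled \<eta> b (y - v))"
      by (simp add: mult.commute)
  qed
  also have "\<dots> = ennreal M"
    using nn_integral_scaled[OF \<eta> ab(2)] by (subst nn_integral_cmult) auto
  finally have fin: "(\<integral>\<^sup>+p. ennreal (?f p) \<partial>(lborel \<Otimes>\<^sub>M lborel)) \<le> ennreal M" .
  show int: "integrable (lborel \<Otimes>\<^sub>M lborel) ?f"
    using nonneg fin by (intro integrableI_nonneg) (auto simp: less_top[symmetric] top_unique)
  show "(\<integral>p. ?f p \<partial>(lborel \<Otimes>\<^sub>M lborel)) \<le> M"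
    using fin nonneg nn_integral_eq_integral[OF int] \<open>0 \<le> M\<close> by (auto simp: ennreal_le_iff)
qed

lemma integral_weight_le_if_snd:
  assumes \<eta>: "mollifier \<eta>" and ab: "0 < a" "0 < b" and "0 \<le> M"
    and [measurable]: "h \<in> borel_measurable (lborel \<Otimes>\<^sub>M lborel)" and h: "\<And>p. 0 \<le> h p"
    and le: "\<And>u. (\<integral>\<^sup>+v. ennreal (scaled \<eta> b (y - v) * h (u, v)) \<partial>lborel) \<le> ennreal M"
  shows "integrable (lborel \<Otimes>\<^sub>M lborel) (\<lambda>p. h p * weight \<eta> a x b y p)"
    and "(\<integral>p. h p * weight \<eta> a x b y p \<partial>(lborel \<Otimes>\<^sub>M lborel)) \<le> M"
proof -
  note [measurable] = measurable_weight[OF \<eta>]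
  have *: "(\<lambda>(u, v). h (v, u) * weight \<eta> a x b y (v, u)) = (\<lambda>p. h (prod.swap p) * weight \<eta> b y a x p)"
    by (auto simp: weight_def fun_eq_iff)
  have **: "(\<lambda>p. h (prod.swap p)) \<in> borel_measurable (lborel \<Otimes>\<^sub>M lborel)"
    unfolding prod.swap_def by measurable
  have swap: "integrable (lborel \<Otimes>\<^sub>M lborel) (\<lambda>p. h (prod.swap p) * weight \<eta> b y a x p)"
    "(\<integral>p. h (prod.swap p) * weight \<eta> b y a x p \<partial>(lborel \<Otimes>\<^sub>M lborel)) \<le> M"
    using integral_weight_le_if_fst[OF \<eta> ab(2,1) \<open>0 \<le> M\<close> **] le h by auto
  show "integrable (lborel \<Otimes>\<^sub>M lborel) (\<lambda>p. h p * weight \<eta> a x b y p)"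
    using lborel_pair.integrable_product_swap[of "\<lambda>p. h (prod.swap p) * weight \<eta> b y a x p", OF swap(1)]
    by (simp add: weight_def mult_ac case_prod_beta')
  then show "(\<integral>p. h p * weight \<eta> a x b y p \<partial>(lborel \<Otimes>\<^sub>M lborel)) \<le> M"
    using lborel_pair.integral_product_swap[of "\<lambda>p. h p * weight \<eta> a x b y p"] swap(2) * by simp
qed

lemma has_bochner_integral_weight:
  assumes \<eta>: "mollifier \<eta>" and ab: "0 < a" "0 < b"
  shows "has_bochner_integral (lborel \<Otimes>\<^sub>M lborel) (weight \<eta> a x b y) 1"
proof -
  have int: "integrable (lborel \<Otimes>\<^sub>M lborel) (weight \<eta> a x b y)"
    using integral_weight_le_if_fst(1)[OF \<eta> ab, of 1 "\<lambda>_. 1" x y] nn_integral_scaled[OF \<eta> ab(1)]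
    by simp
  have "(\<integral>p. weight \<eta> a x b y p \<partial>(lborel \<Otimes>\<^sub>M lborel)) = (\<integral>v. \<integral>u. weight \<eta> a x b y (u, v) \<partial>lborel \<partial>lborel)"
    using lborel_pair.integral_snd[of "\<lambda>u v. weight \<eta> a x b y (u, v)"] int by simp
  also have "\<dots> = 1"
    using has_bochner_integral_scaled[OF \<eta>] ab by (simp add: weight_def has_bochner_integral_iff)
  finally show ?thesis using int by (simp add: has_bochner_integral_iff)
qed

text \<open>The pole at scale \<open>a\<close> has mass of order \<open>a ^ DIM('a)\<close>, which is exactly compensated by the height
  \<open>B / a ^ DIM('a)\<close> of the mollifier; hence a bound that does not depend on the scales.\<close>

lemma integral_log_pole_weight:
  fixes x y :: "'a::euclidean_space"
  assumes \<eta>: "mollifier \<eta>" and ab: "0 < a" "0 < b" and B: "\<And>x. \<bar>\<eta> x\<bar> \<le> B"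
  shows "integrable (lborel \<Otimes>\<^sub>M lborel) (\<lambda>p. log_pole (norm (fst p - snd p) / a) * weight \<eta> a x b y p)"
      (is "integrable _ (\<lambda>p. ?h a p * _)")
    and "(\<integral>p. log_pole (norm (fst p - snd p) / a) * weight \<eta> a x b y p \<partial>(lborel \<Otimes>\<^sub>M lborel)) \<le> B * log_pole_mass TYPE('a)"
    and "integrable (lborel \<Otimes>\<^sub>M lborel) (\<lambda>p. log_pole (norm (fst p - snd p) / b) * weight \<eta> a x b y p)"
    and "(\<integral>p. log_pole (norm (fst p - snd p) / b) * weight \<eta> a x b y p \<partial>(lborel \<Otimes>\<^sub>M lborel)) \<le> B * log_pole_mass TYPE('a)"
proof -
  have B0: "0 \<le> B" using B[of 0] by linarith
  have *: "(\<integral>\<^sup>+u. ennreal (scaled \<eta> c (z - u) * log_pole (norm (u - v) / c)) \<partial>lborel) \<le> ennreal (B * log_pole_mass TYPE('a))"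
    if c: "0 < c" for c z and v :: 'a
  proof -
    have "(\<integral>\<^sup>+u. ennreal (scaled \<eta> c (z - u) * log_pole (norm (u - v) / c)) \<partial>lborel)
        \<le> (\<integral>\<^sup>+u. ennreal (B / c ^ DIM('a)) * ennreal (log_pole (norm (u - v) / c)) \<partial>lborel)"
    proof (rule nn_integral_mono)
      fix u :: 'a
      have "scaled \<eta> c (z - u) * log_pole (norm (u - v) / c) \<le> B / c ^ DIM('a) * log_pole (norm (u - v) / c)"
        using scaled_le[of \<eta> B c, OF B c] by (intro mult_right_mono) auto
      then show "ennreal (scaled \<eta> c (z - u) * log_pole (norm (u - v) / c))
          \<le> ennreal (B / c ^ DIM('a)) * ennreal (log_pole (norm (u - v) / c))"
        using c B0 by (simp add: ennreal_leI flip: ennreal_mult)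
    qed
    also have "\<dots> = ennreal (B / c ^ DIM('a)) * (\<integral>\<^sup>+u. ennreal (log_pole (norm (u - v) / c)) \<partial>lborel)"
      by (rule nn_integral_cmult) measurable
    also have "\<dots> \<le> ennreal (B / c ^ DIM('a)) * ennreal (c ^ DIM('a) * log_pole_mass TYPE('a))"
      using nn_integral_log_pole_le[OF c] by (intro mult_left_mono) auto
    also have "\<dots> = ennreal (B * log_pole_mass TYPE('a))"
      using c B0 by (simp flip: ennreal_mult)
    finally show ?thesis .
  qed
  have M: "0 \<le> B * log_pole_mass TYPE('a)" using B0 by simp
  have [measurable]: "?h c \<in> borel_measurable (lborel \<Otimes>\<^sub>M lborel)" for c by measurable
  show "integrable (lborel \<Otimes>\<^sub>M lborel) (\<lambda>p. ?h a p * weight \<eta> a x b y p)"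
    "(\<integral>p. ?h a p * weight \<eta> a x b y p \<partial>(lborel \<Otimes>\<^sub>M lborel)) \<le> B * log_pole_mass TYPE('a)"
    using integral_weight_le_if_fst[OF \<eta> ab M, of "?h a" x y] *[OF ab(1)] by simp_all
  show "integrable (lborel \<Otimes>\<^sub>M lborel) (\<lambda>p. ?h b p * weight \<eta> a x b y p)"
    "(\<integral>p. ?h b p * weight \<eta> a x b y p \<partial>(lborel \<Otimes>\<^sub>M lborel)) \<le> B * log_pole_mass TYPE('a)"
    using integral_weight_le_if_snd[OF \<eta> ab M, of "?h b" y x] *[OF ab(2)]
    by (simp_all add: norm_minus_commute)
qed

lemma weight_le:
  fixes x y :: "'a::euclidean_space"
  assumes \<eta>: "mollifier \<eta>" and ab: "0 < a" "0 < b" and B: "\<And>x. \<bar>\<eta> x\<bar> \<le> B"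
  shows "weight \<eta> a x b y p \<le> B / a ^ DIM('a) * (B / b ^ DIM('a))"
proof -
  have "0 \<le> B" using B[of 0] by linarith
  then show ?thesis
    unfolding weight_def using scaled_le[of \<eta> B, OF B] scaled_nonneg[OF \<eta>] ab by (intro mult_mono) auto
qed

lemma cov_integrable_and_bound:
  fixes x y :: "'a::euclidean_space"
  assumes lc: "log_correlated_kernel U g"
    and \<eta>: "mollifier \<eta>" and ab: "0 < a" "0 < b" and B: "\<And>x. \<bar>\<eta> x\<bar> \<le> B"
  shows "integrable (lborel \<Otimes>\<^sub>M lborel) (\<lambda>p. log_kernel U g (fst p) (snd p) * weight \<eta> a x b y p)"
    and "\<bar>cov U g \<eta> a x b y\<bar> \<le> B / a ^ DIM('a) * (B / b ^ DIM('a))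
      * (\<integral>p. \<bar>log_kernel U g (fst p) (snd p)\<bar> \<partial>(lborel \<Otimes>\<^sub>M lborel))"
proof -
  let ?K = "\<lambda>p. log_kernel U g (fst p) (snd p)" and ?c = "B / a ^ DIM('a) * (B / b ^ DIM('a))"
  note [measurable] = measurable_weight[OF \<eta>]
  have K: "integrable (lborel \<Otimes>\<^sub>M lborel) ?K"
    using log_kernel_integrable[OF lc] by (simp add: case_prod_beta')
  then have [measurable]: "?K \<in> borel_measurable (lborel \<Otimes>\<^sub>M lborel)" by simp
  have le: "\<bar>?K p * weight \<eta> a x b y p\<bar> \<le> ?c * \<bar>?K p\<bar>" for p
    using mult_right_mono[OF weight_le[OF \<eta> ab B, of x y p] abs_ge_zero[of "?K p"]]
      weight_nonneg[OF \<eta> ab, of x y p] by (simp add: abs_mult mult.commute)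
  show int: "integrable (lborel \<Otimes>\<^sub>M lborel) (\<lambda>p. ?K p * weight \<eta> a x b y p)"
  proof (rule Bochner_Integration.integrable_bound)
    show "integrable (lborel \<Otimes>\<^sub>M lborel) (\<lambda>p. ?c * \<bar>?K p\<bar>)" using K by auto
    show "AE p in lborel \<Otimes>\<^sub>M lborel. norm (?K p * weight \<eta> a x b y p) \<le> norm (?c * \<bar>?K p\<bar>)"
      using order_trans[OF le abs_ge_self] unfolding real_norm_def by (intro always_eventually allI)
  qed measurable
  have "\<bar>cov U g \<eta> a x b y\<bar> \<le> (\<integral>p. \<bar>?K p * weight \<eta> a x b y p\<bar> \<partial>(lborel \<Otimes>\<^sub>M lborel))"
    unfolding cov_def by (rule integral_abs_bound)
  also have "\<dots> \<le> (\<integral>p. ?c * \<bar>?K p\<bar> \<partial>(lborel \<Otimes>\<^sub>M lborel))"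
    using int K le by (intro integral_mono) auto
  finally show "\<bar>cov U g \<eta> a x b y\<bar> \<le> ?c * (\<integral>p. \<bar>?K p\<bar> \<partial>(lborel \<Otimes>\<^sub>M lborel))" by simp
qed

text \<open>Let \<open>R\<close> be the maximum of \<open>r\<close>, \<open>a\<close> and \<open>b\<close>. Either one of the scales is at least \<open>R/4\<close>, and then
  its pole controls \<open>ln (R/t)\<close>, or both scales are small and \<open>r \<le> t + a + b\<close> forces \<open>t\<close> to be
  comparable with \<open>R\<close>.\<close>

lemma ln_ratio_le_log_poles:
  fixes a b r t :: real
  assumes "0 < a" "0 < b" "0 < t" "r \<le> t + a + b"
  shows "ln (max r (max a b)) - ln t \<le> ln 4 + log_pole (t / a) + log_pole (t / b)"
proof -
  have near: "ln R - ln t \<le> ln 4 + log_pole (t / c)" if "0 < R" "R \<le> 4 * c" for R c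
  proof -
    have "0 < c" using that by simp
    have "ln R \<le> ln (4 * c)" using that by (subst ln_le_cancel_iff) auto
    also have "\<dots> = ln 4 + ln c" using \<open>0 < c\<close> by (simp add: ln_mult)
    also have "ln c - ln t \<le> log_pole (t / c)"
      using \<open>0 < c\<close> assms by (simp add: log_pole_def ln_div)
    then have "ln 4 + ln c \<le> ln 4 + log_pole (t / c) + ln t" by simp
    finally show ?thesis by simp
  qed
  let ?R = "max r (max a b)"
  have R: "0 < ?R" using assms by auto
  consider "?R \<le> 4 * a" | "?R \<le> 4 * b" | "?R > 4 * a" "?R > 4 * b" by linarith
  then show ?thesis
  proof cases
    case 1
    then show ?thesis using near[OF R 1] log_pole_nonneg[of "t / b"] by linarith
  next
    case 2
    then show ?thesis using near[OF R 2] log_pole_nonneg[of "t / a"] by linarith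
  next
    case 3
    then have "?R \<le> 4 * t" using assms by (auto simp: max_def split: if_splits)
    then have "ln ?R \<le> ln (4 * t)" using R assms by (subst ln_le_cancel_iff) auto
    also have "\<dots> = ln 4 + ln t" using assms by (simp add: ln_mult)
    finally show ?thesis using log_pole_nonneg[of "t / a"] log_pole_nonneg[of "t / b"] by linarith
  qed
qed

text \<open>Let \<open>R\<close> be the largest of \<open>dist x y\<close>, \<open>a\<close> and \<open>b\<close>. Smearing replaces the distance in the
  logarithm by \<open>R\<close>, up to an error that depends neither on the scales nor on the points: the lower
  bound holds pointwise, since points of the two balls are at distance at most \<open>3 R\<close>, the upper
  bound after averaging the poles.\<close>

lemma cov_estimate:
  fixes x y :: "'a::euclidean_space"
  assumes lc: "log_correlated_kernel U g"
    and \<eta>: "mollifier \<eta>" and ab: "0 < a" "0 < b" and B: "\<And>x. \<bar>\<eta> x\<bar> \<le> B"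
    and sub: "ball x a \<subseteq> U" "ball y b \<subseteq> U"
    and G: "\<And>u v. u \<in> ball x a \<Longrightarrow> v \<in> ball y b \<Longrightarrow> \<bar>g (u, v)\<bar> \<le> G"
  shows "\<bar>cov U g \<eta> a x b y + ln (max (dist x y) (max a b))\<bar> \<le> ln 4 + G + 2 * (B * log_pole_mass TYPE('a))"
proof -
  let ?M = "lborel \<Otimes>\<^sub>M (lborel :: 'a measure)" and ?w = "weight \<eta> a x b y"
  let ?K = "\<lambda>p. log_kernel U g (fst p) (snd p)"
  let ?R = "max (dist x y) (max a b)"
  let ?P = "\<lambda>p. log_pole (norm (fst p - snd p) / a)" and ?Q = "\<lambda>p. log_pole (norm (fst p - snd p) / b)"
  note w = has_bochner_integral_weight[OF \<eta> ab, of x y, unfolded has_bochner_integral_iff]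
  note pole = integral_log_pole_weight[OF \<eta> ab B, of x y]
  note K = cov_integrable_and_bound(1)[OF lc \<eta> ab B, of x y]
  have R: "0 < ?R" using ab by auto
  \<comment> \<open>On the diagonal the kernel takes the value of ln (1 / 0), which is 0, so the bounds hold only almost everywhere.\<close>
  have bounds: "AE p in ?M. (- ln ?R - ln 4 - G) * ?w p \<le> ?K p * ?w p
      \<and> ?K p * ?w p \<le> (- ln ?R + ln 4 + G) * ?w p + ?P p * ?w p + ?Q p * ?w p"
    using AE_offdiagonal
  proof (rule AE_mp, intro AE_I2 impI)
    fix p :: "'a \<times> 'a"
    assume ne: "fst p \<noteq> snd p"
    show "(- ln ?R - ln 4 - G) * ?w p \<le> ?K p * ?w p
      \<and> ?K p * ?w p \<le> (- ln ?R + ln 4 + G) * ?w p + ?P p * ?w p + ?Q p * ?w p"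
    proof (cases "fst p \<in> ball x a \<and> snd p \<in> ball y b")
      case False
      then show ?thesis using weight_outside[OF \<eta> ab False] by simp
    next
      case True
      define t where "t = norm (fst p - snd p)"
      have t: "0 < t" using ne by (simp add: t_def)
      have "dist x (fst p) < a" "dist y (snd p) < b" using True by auto
      moreover have "dist x y \<le> dist x (fst p) + t + dist y (snd p)"
        using dist_triangle[of x y "fst p"] dist_triangle[of "fst p" y "snd p"]
        by (simp add: t_def dist_norm norm_minus_commute)
      moreover have "t \<le> dist x (fst p) + dist x y + dist y (snd p)"
        using dist_triangle[of "fst p" "snd p" x] dist_triangle[of x "snd p" y]
        by (simp add: t_def dist_norm norm_minus_commute)
      ultimately have 1: "dist x y \<le> t + a + b" and 2: "t \<le> 4 * ?R" using R by linarith+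
      have "ln t \<le> ln (4 * ?R)" using t 2 R by (subst ln_le_cancel_iff) auto
      then have lo: "ln t \<le> ln 4 + ln ?R" using R by (simp add: ln_mult)
      have hi: "ln ?R - ln t \<le> ln 4 + ?P p + ?Q p"
        using ln_ratio_le_log_poles[OF ab t 1] by (simp add: t_def)
      have K_eq: "?K p = - ln t + g (fst p, snd p)"
        using True sub t by (auto simp: log_kernel_def t_def ln_div)
      have "\<bar>g (fst p, snd p)\<bar> \<le> G" using True G by blast
      then have "- ln ?R - ln 4 - G \<le> ?K p" "?K p \<le> (- ln ?R + ln 4 + G) + ?P p + ?Q p"
        using lo hi K_eq by linarith+
      then have "(- ln ?R - ln 4 - G) * ?w p \<le> ?K p * ?w p"
        "?K p * ?w p \<le> ((- ln ?R + ln 4 + G) + ?P p + ?Q p) * ?w p"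
        using weight_nonneg[OF \<eta> ab] by (intro mult_right_mono; simp)+
      then show ?thesis by (simp only: distrib_right)
    qed
  qed
  have "(\<integral>p. (- ln ?R - ln 4 - G) * ?w p \<partial>?M) \<le> cov U g \<eta> a x b y"
    unfolding cov_def using w K bounds by (intro integral_mono_AE) auto
  moreover have "cov U g \<eta> a x b y \<le> (\<integral>p. (- ln ?R + ln 4 + G) * ?w p + ?P p * ?w p + ?Q p * ?w p \<partial>?M)"
    unfolding cov_def using w K bounds pole by (intro integral_mono_AE) auto
  moreover have "(\<integral>p. (- ln ?R + ln 4 + G) * ?w p + ?P p * ?w p + ?Q p * ?w p \<partial>?M)
      = (- ln ?R + ln 4 + G) + (\<integral>p. ?P p * ?w p \<partial>?M) + (\<integral>p. ?Q p * ?w p \<partial>?M)"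
    using w pole by simp
  moreover have "(\<integral>p. (- ln ?R - ln 4 - G) * ?w p \<partial>?M) = - ln ?R - ln 4 - G" using w by simp
  moreover have "0 \<le> B * log_pole_mass TYPE('a)" using B[of 0] by simp
  ultimately show ?thesis using pole(2,4) by linarith
qed

text \<open>Positive definiteness of the kernel, tested against the superposition of the smeared charges.\<close>

lemma cov_quadratic_form_nonneg:
  fixes x :: "'i \<Rightarrow> 'a::euclidean_space"
  assumes lc: "log_correlated_kernel U g" and \<eta>: "mollifier \<eta>" and "finite I"
    and a: "\<And>i. i \<in> I \<Longrightarrow> 0 < a i"
  shows "0 \<le> (\<Sum>i\<in>I. \<Sum>j\<in>I. q i * q j * cov U g \<eta> (a i) (x i) (a j) (x j))"
proof -
  let ?M = "lborel \<Otimes>\<^sub>M (lborel :: 'a measure)"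
  let ?K = "\<lambda>p. log_kernel U g (fst p) (snd p)"
  define F where "F u = (\<Sum>i\<in>I. q i * scaled \<eta> (a i) (x i - u))" for u
  obtain B where B: "\<And>x. \<bar>\<eta> x\<bar> \<le> B" using test_function_bounded[OF mollifier_test_function[OF \<eta>]] by metis
  have "test_function F"
    unfolding F_def[abs_def]
    by (intro test_function_sum test_function_bounded_linear_image[OF bounded_linear_mult_right]
        test_function_scaled \<eta> a \<open>finite I\<close>)
  then have "test_function (\<lambda>u. complex_of_real (F u))"
    by (rule test_function_bounded_linear_image[OF bounded_linear_of_real])
  then have "(\<integral>(u, v). complex_of_real (log_kernel U g u v) * complex_of_real (F u) * cnj (complex_of_real (F v)) \<partial>?M) \<in> \<real>\<^sub>\<ge>\<^sub>0"
    using lc unfolding log_correlated_kernel_def covariance_kernel_def by blast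
  also have "(\<integral>(u, v). complex_of_real (log_kernel U g u v) * complex_of_real (F u) * cnj (complex_of_real (F v)) \<partial>?M)
      = (\<integral>p. complex_of_real (?K p * (F (fst p) * F (snd p))) \<partial>?M)"
    by (simp add: case_prod_beta' mult.assoc)
  finally have "0 \<le> (\<integral>p. ?K p * (F (fst p) * F (snd p)) \<partial>?M)"
    by (simp only: integral_complex_of_real nonneg_Reals_of_real_iff)
  also have "(\<lambda>p. ?K p * (F (fst p) * F (snd p)))
      = (\<lambda>p. \<Sum>i\<in>I. \<Sum>j\<in>I. q i * q j * (?K p * weight \<eta> (a i) (x i) (a j) (x j) p))"
    by (simp only: F_def sum_product) (simp add: weight_def sum_distrib_left mult_ac)
  also have "(\<integral>p. (\<Sum>i\<in>I. \<Sum>j\<in>I. q i * q j * (?K p * weight \<eta> (a i) (x i) (a j) (x j) p)) \<partial>?M)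
      = (\<Sum>i\<in>I. \<Sum>j\<in>I. q i * q j * cov U g \<eta> (a i) (x i) (a j) (x j))"
  proof -
    have "integrable ?M (\<lambda>p. q i * q j * (?K p * weight \<eta> (a i) (x i) (a j) (x j) p))" if "i \<in> I" "j \<in> I" for i j
      using cov_integrable_and_bound(1)[OF lc \<eta> a[OF that(1)] a[OF that(2)] B] by simp
    then show ?thesis
      unfolding cov_def by (simp add: Bochner_Integration.integral_sum cong: sum.cong)
  qed
  finally show ?thesis .
qed

section \<open>Invariance of Lebesgue measure under isometries\<close>

text \<open>A linear map that permutes orthonormal bases pulls boxes back to boxes with the same side
  lengths.\<close>

lemma lborel_distr_basis_isomorphism:
  fixes \<phi> :: "'b::euclidean_space \<Rightarrow> 'a::euclidean_space"
  assumes lin: "linear \<phi>" and bij: "bij_betw \<phi> Basis Basis"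
  shows "distr lborel borel \<phi> = lborel"
proof (rule lborel_eqI[symmetric])
  have meas [measurable]: "\<phi> \<in> borel_measurable borel"
    using lin by (intro borel_measurable_continuous_onI linear_continuous_on) (simp add: linear_conv_bounded_linear)
  have coord: "\<phi> z \<bullet> \<phi> c = z \<bullet> c" if "c \<in> Basis" for z c
  proof -
    have inj: "\<phi> d = \<phi> c \<longleftrightarrow> d = c" if "d \<in> Basis" for d
      using bij \<open>c \<in> Basis\<close> that by (auto simp: bij_betw_def inj_on_def)
    have "\<phi> z = \<phi> (\<Sum>d\<in>Basis. (z \<bullet> d) *\<^sub>R d)" by (simp add: euclidean_representation)
    also have "\<dots> = (\<Sum>d\<in>Basis. (z \<bullet> d) *\<^sub>R \<phi> d)"
      by (simp add: linear_sum[OF lin] linear_scale[OF lin])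
    finally have "\<phi> z \<bullet> \<phi> c = (\<Sum>d\<in>Basis. (z \<bullet> d) * (\<phi> d \<bullet> \<phi> c))" by (simp add: inner_sum_left)
    also have "\<dots> = (\<Sum>d\<in>Basis. if d = c then z \<bullet> c else 0)"
    proof (intro sum.cong refl)
      fix d :: 'b assume d: "d \<in> Basis"
      have "\<phi> d \<in> Basis" "\<phi> c \<in> Basis" using bij that d by (auto simp: bij_betw_def)
      then show "(z \<bullet> d) * (\<phi> d \<bullet> \<phi> c) = (if d = c then z \<bullet> c else 0)"
        using inj[OF d] by (simp add: inner_Basis)
    qed
    finally show ?thesis using that by simp
  qed
  fix l u :: 'a
  assume lu: "\<And>b. b \<in> Basis \<Longrightarrow> l \<bullet> b \<le> u \<bullet> b"
  define \<psi> :: "'a \<Rightarrow> 'b" where "\<psi> w = (\<Sum>c\<in>Basis. (w \<bullet> \<phi> c) *\<^sub>R c)" for w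
  have \<psi>: "\<psi> w \<bullet> c = w \<bullet> \<phi> c" if "c \<in> Basis" for w c
    using that by (simp add: \<psi>_def)
  have "\<phi> -` box l u = box (\<psi> l) (\<psi> u)"
  proof (intro set_eqI)
    fix z
    have "z \<in> \<phi> -` box l u \<longleftrightarrow> (\<forall>b\<in>\<phi> ` Basis. l \<bullet> b < \<phi> z \<bullet> b \<and> \<phi> z \<bullet> b < u \<bullet> b)"
      using bij_betw_imp_surj_on[OF bij] by (simp add: mem_box)
    also have "\<dots> \<longleftrightarrow> z \<in> box (\<psi> l) (\<psi> u)"
      by (simp add: mem_box coord \<psi>)
    finally show "z \<in> \<phi> -` box l u \<longleftrightarrow> z \<in> box (\<psi> l) (\<psi> u)" .
  qed
  then have "emeasure (distr lborel borel \<phi>) (box l u) = emeasure lborel (box (\<psi> l) (\<psi> u))"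
    by (subst emeasure_distr) auto
  also have "\<dots> = (\<Prod>c\<in>Basis. (\<psi> u - \<psi> l) \<bullet> c)"
    using lu bij_betwE[OF bij] by (intro emeasure_lborel_box) (simp add: \<psi>)
  also have "(\<Prod>c\<in>Basis. (\<psi> u - \<psi> l) \<bullet> c) = (\<Prod>c\<in>Basis. (u - l) \<bullet> \<phi> c)"
    using \<psi> by (intro prod.cong) (auto simp: inner_diff_left)
  also have "\<dots> = (\<Prod>b\<in>Basis. (u - l) \<bullet> b)"
    by (rule prod.reindex_bij_betw[OF bij])
  finally show "emeasure (distr lborel borel \<phi>) (box l u) = (\<Prod>b\<in>Basis. (u - l) \<bullet> b)" .
qed simp

lemma lborel_distr_orthogonal:
  fixes T :: "real ^ 'n::{finite, wellorder} \<Rightarrow> real ^ 'n::_"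
  assumes T: "orthogonal_transformation T"
  shows "distr lborel borel T = lborel"
proof (rule lborel_eqI[symmetric])
  have [measurable]: "T \<in> borel_measurable borel"
    using orthogonal_transformation_linear[OF T]
    by (intro borel_measurable_continuous_onI linear_continuous_on) (simp add: linear_conv_bounded_linear)
  fix l u :: "real ^ 'n::_"
  assume lu: "\<And>b. b \<in> Basis \<Longrightarrow> l \<bullet> b \<le> u \<bullet> b"
  have pre: "T -` box l u = inv T ` box l u"
    using bij_vimage_eq_inv_image[OF orthogonal_transformation_bij[OF T]] .
  have meas: "T -` box l u \<in> sets borel"
    using measurable_sets[of T borel borel "box l u"] by simp
  have orth: "orthogonal_transformation (inv T)" by (rule orthogonal_transformation_inv[OF T])
  have "emeasure (distr lborel borel T) (box l u) = emeasure lebesgue (inv T ` box l u)"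
    using meas by (subst emeasure_distr) (auto simp: pre[symmetric] emeasure_lborel_cbox)
  also have "\<dots> = emeasure lebesgue (box l u)"
    using measurable_orthogonal_image[OF orth, of "box l u"] measure_orthogonal_image[OF orth, of "box l u"]
    by (simp add: emeasure_eq_measure2)
  also have "\<dots> = (\<Prod>b\<in>Basis. (u - l) \<bullet> b)"
    using lu by (simp add: emeasure_lborel_box)
  finally show "emeasure (distr lborel borel T) (box l u) = (\<Prod>b\<in>Basis. (u - l) \<bullet> b)" .
qed simp

text \<open>Transported from the orthogonal group of \<open>real ^ 2\<close>, where the change of variables by
  determinants applies.\<close>

lemma lborel_distr_rotation:
  fixes w :: complex
  assumes w: "norm w = 1"
  shows "distr lborel borel ((*) w) = lborel"
proof -
  define \<phi> :: "real ^ 2 \<Rightarrow> complex" where "\<phi> v = Complex (v $ 1) (v $ 2)" for v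
  define \<psi> :: "complex \<Rightarrow> real ^ 2" where "\<psi> z = vector [Re z, Im z]" for z
  have \<phi>\<psi>: "\<phi> (\<psi> z) = z" for z by (simp add: \<phi>_def \<psi>_def)
  have lin_\<phi>: "linear \<phi>" by (rule linearI) (auto simp: \<phi>_def complex_eq_iff)
  have lin_\<psi>: "linear \<psi>"
    by (rule linearI) (auto simp: \<psi>_def vec_eq_iff forall_2)
  have "bij_betw \<phi> Basis Basis"
  proof -
    have B: "(Basis :: (real ^ 2) set) = {axis 1 1, axis 2 1}" by (auto simp: Basis_vec_def UNIV_2)
    have "\<phi> (axis 1 1) = 1" "\<phi> (axis 2 1) = \<i>" by (auto simp: \<phi>_def axis_def complex_eq_iff)
    then show ?thesis
      unfolding B Basis_complex_def by (auto simp: bij_betw_def inj_on_def)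
  qed
  then have \<phi>: "distr lborel borel \<phi> = lborel"
    by (rule lborel_distr_basis_isomorphism[OF lin_\<phi>])
  have norm_\<phi>: "norm (\<phi> v) = norm v" for v
    by (simp add: \<phi>_def norm_vec_def L2_set_def sum_2 cmod_def)
  define T where "T v = \<psi> (w * \<phi> v)" for v
  have "linear T"
    unfolding T_def[abs_def] using linear_compose[OF linear_compose[OF lin_\<phi>, of "(*) w"] lin_\<psi>]
    by (simp add: o_def bounded_linear.linear[OF bounded_linear_mult_right])
  moreover have "norm (T v) = norm v" for v
    using w by (simp add: T_def norm_\<phi>[symmetric] \<phi>\<psi> norm_mult)
  ultimately have T: "distr lborel borel T = lborel"
    by (intro lborel_distr_orthogonal) (simp add: orthogonal_transformation)
  have [measurable]: "\<phi> \<in> borel_measurable borel" "T \<in> borel_measurable borel"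
    using lin_\<phi> \<open>linear T\<close>
    by (auto intro!: borel_measurable_continuous_onI linear_continuous_on simp: linear_conv_bounded_linear)
  have "distr lborel borel ((*) w) = distr (distr lborel borel \<phi>) borel ((*) w)" by (simp add: \<phi>)
  also have "\<dots> = distr lborel borel (\<lambda>v. w * \<phi> v)" by (subst distr_distr) (auto simp: o_def)
  also have "\<dots> = distr lborel borel (\<lambda>v. \<phi> (T v))" by (simp add: T_def \<phi>\<psi>)
  also have "\<dots> = distr (distr lborel borel T) borel \<phi>" by (subst distr_distr) (auto simp: o_def)
  also have "\<dots> = lborel" by (simp add: T \<phi>)
  finally show ?thesis .
qed

section \<open>The mean value property of the logarithm in the plane\<close>

lemma abs_ln_norm_one_minus_le:
  fixes w :: complex
  assumes "norm w \<le> s" "s < 1"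
  shows "\<bar>ln (norm (1 - w))\<bar> \<le> ln 2 - ln (1 - s)"
proof -
  have "1 - s \<le> norm (1 - w)" using norm_triangle_ineq2[of 1 w] assms by simp
  moreover have "norm (1 - w) \<le> 2" using norm_triangle_ineq4[of 1 w] assms by simp
  moreover have "0 \<le> s" using assms norm_ge_zero order_trans by blast
  ultimately have "ln (1 - s) \<le> ln (norm (1 - w))" "ln (norm (1 - w)) \<le> ln 2" "ln (1 - s) \<le> 0"
    using assms by (auto intro!: ln_mono)
  moreover have "0 \<le> ln (2::real)" by simp
  ultimately show ?thesis unfolding abs_le_iff by linarith
qed

text \<open>The mean value property of \<open>ln \<bar>\<zeta> - z\<bar>\<close>, averaged over circles by the radial
  density \<open>\<rho>\<close>, without contour integration. After division by \<open>\<zeta>\<close> one has to show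
  \<open>I 1 = 0\<close>, where \<open>I k\<close> is the integral of \<open>\<rho> z * ln \<bar>1 - (z/\<zeta>)\<^sup>k\<bar>\<close>. Rotation
  by a \<open>k\<close>-th root of \<open>- 1\<close> replaces \<open>1 - w\<close> by \<open>1 + w\<close>, where \<open>w = (z/\<zeta>)\<^sup>k\<close>, and leaves \<open>I k\<close>
  unchanged; since \<open>(1 - w) (1 + w) = 1 - w\<^sup>2\<close>, this gives \<open>I (2 k) = 2 I k\<close>. All \<open>I k\<close> obey the
  same bound, so \<open>I 1 = 0\<close>.\<close>

lemma log_mean_value_complex:
  fixes \<rho> :: "complex \<Rightarrow> real"
  assumes \<rho>: "integrable lborel \<rho>" and radial: "\<And>z w. norm z = norm w \<Longrightarrow> \<rho> z = \<rho> w"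
    and supp: "\<And>z. \<rho> z \<noteq> 0 \<Longrightarrow> norm z \<le> c" and c: "c < norm \<zeta>"
  shows "(\<integral>z. \<rho> z * ln (norm (\<zeta> - z)) \<partial>lborel) = (\<integral>z. \<rho> z \<partial>lborel) * ln (norm \<zeta>)"
proof (cases "\<zeta> = 0")
  case True
  then have "\<rho> z = 0" for z using c supp[of z] norm_ge_zero[of z] by fastforce
  then show ?thesis by simp
next
  case False
  define s where "s = max c 0 / norm \<zeta>"
  have s: "0 \<le> s" "s < 1" using c False by (auto simp: s_def)
  have small: "norm (z / \<zeta>) \<le> s" if "\<rho> z \<noteq> 0" for z
    using supp[OF that] False by (auto simp: s_def norm_divide intro!: divide_right_mono)
  have [measurable]: "\<rho> \<in> borel_measurable borel" using \<rho> by (simp add: borel_measurable_integrable)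
  define f where "f k z = \<rho> z * ln (norm (1 - (z / \<zeta>) ^ k))" for k :: nat and z
  define L where "L = ln 2 - ln (1 - s)"
  have [measurable]: "f k \<in> borel_measurable borel" for k unfolding f_def[abs_def] by measurable
  have bound: "\<bar>f k z\<bar> \<le> L * \<bar>\<rho> z\<bar>" if "k \<ge> 1" for k z
  proof (cases "\<rho> z = 0")
    case False
    have "norm ((z / \<zeta>) ^ k) \<le> s ^ k"
      unfolding norm_power using small[OF False] by (intro power_mono) auto
    also have "\<dots> \<le> s ^ 1" using s that by (intro power_decreasing) auto
    finally have "\<bar>ln (norm (1 - (z / \<zeta>) ^ k))\<bar> \<le> L"
      unfolding L_def using s by (intro abs_ln_norm_one_minus_le) auto
    then show ?thesis by (simp add: f_def abs_mult mult.commute[of L] mult_left_mono)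
  qed (simp add: f_def)
  have int: "integrable lborel (f k)" if "k \<ge> 1" for k
  proof (rule Bochner_Integration.integrable_bound)
    show "integrable lborel (\<lambda>z. L * \<bar>\<rho> z\<bar>)" using \<rho> by auto
    show "AE z in lborel. norm (f k z) \<le> norm (L * \<bar>\<rho> z\<bar>)"
      using order_trans[OF bound[OF that] abs_ge_self] unfolding real_norm_def
      by (intro always_eventually allI)
  qed measurable
  define I where "I k = (\<integral>z. f k z \<partial>lborel)" for k
  have I_bound: "\<bar>I k\<bar> \<le> L * (\<integral>z. \<bar>\<rho> z\<bar> \<partial>lborel)" if "k \<ge> 1" for k
  proof -
    have "\<bar>I k\<bar> \<le> (\<integral>z. \<bar>f k z\<bar> \<partial>lborel)" unfolding I_def by (rule integral_abs_bound)
    also have "\<dots> \<le> (\<integral>z. L * \<bar>\<rho> z\<bar> \<partial>lborel)"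
      using int[OF that] \<rho> bound[OF that] by (intro integral_mono) auto
    finally show ?thesis by simp
  qed
  have double: "I (2 * k) = 2 * I k" if "k \<ge> 1" for k
  proof -
    \<comment> \<open>A \<open>k\<close>-th root of \<open>- 1\<close> on the unit circle.\<close>
    define w where "w = exp (\<i> * of_real (pi / real k))"
    have w: "norm w = 1" by (simp add: w_def)
    have "w ^ k = exp (\<i> * of_real pi)"
      using that unfolding w_def exp_of_nat_mult[symmetric] by simp
    then have wk: "w ^ k = - 1" by simp
    have "I k = (\<integral>z. f k z \<partial>distr lborel borel ((*) w))"
      by (simp add: I_def lborel_distr_rotation[OF w])
    also have "\<dots> = (\<integral>z. f k (w * z) \<partial>lborel)" by (rule integral_distr) measurable
    also have "(\<lambda>z. f k (w * z)) = (\<lambda>z. \<rho> z * ln (norm (1 + (z / \<zeta>) ^ k)))"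
      using radial[of "w * z" z for z] w wk
      by (simp add: f_def fun_eq_iff norm_mult power_divide power_mult_distrib)
    finally have I_rot: "I k = (\<integral>z. \<rho> z * ln (norm (1 + (z / \<zeta>) ^ k)) \<partial>lborel)" .
    have int_rot: "integrable lborel (\<lambda>z. \<rho> z * ln (norm (1 + (z / \<zeta>) ^ k)))"
    proof -
      have "integrable (distr lborel borel ((*) w)) (f k)"
        using int[OF that] by (simp add: lborel_distr_rotation[OF w])
      then have "integrable lborel (\<lambda>z. f k (w * z))" by (subst (asm) integrable_distr_eq) auto
      also have "(\<lambda>z. f k (w * z)) = (\<lambda>z. \<rho> z * ln (norm (1 + (z / \<zeta>) ^ k)))"
        using radial[of "w * z" z for z] w wk
        by (simp add: f_def fun_eq_iff norm_mult power_divide power_mult_distrib)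
      finally show ?thesis .
    qed
    have "f (2 * k) z = f k z + \<rho> z * ln (norm (1 + (z / \<zeta>) ^ k))" for z
    proof (cases "\<rho> z = 0")
      case False
      let ?u = "(z / \<zeta>) ^ k"
      have "norm ?u \<le> s ^ k"
        unfolding norm_power using small[OF False] by (intro power_mono) auto
      also have "\<dots> < 1" using s that by (simp add: power_less_one_iff)
      finally have u: "norm ?u < 1" .
      have "1 - ?u \<noteq> 0" "1 + ?u \<noteq> 0"
        using u by (auto simp: add_eq_0_iff)
      then have "ln (norm ((1 - ?u) * (1 + ?u))) = ln (norm (1 - ?u)) + ln (norm (1 + ?u))"
        by (simp add: norm_mult ln_mult)
      also have "(1 - ?u) * (1 + ?u) = 1 - (z / \<zeta>) ^ (2 * k)"
        by (simp only: mult_2 power_add) (simp add: algebra_simps)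
      finally show ?thesis by (simp add: f_def distrib_left)
    qed (simp add: f_def)
    then have "I (2 * k) = (\<integral>z. f k z + \<rho> z * ln (norm (1 + (z / \<zeta>) ^ k)) \<partial>lborel)"
      by (simp add: I_def)
    also have "\<dots> = I k + I k"
      using int[OF that] int_rot I_rot by (simp add: I_def)
    finally show ?thesis by simp
  qed
  have I_pow: "I (2 ^ n) = 2 ^ n * I 1" for n
    by (induction n) (use double in auto)
  define J where "J = L * (\<integral>z. \<bar>\<rho> z\<bar> \<partial>lborel)"
  have "2 ^ n * \<bar>I 1\<bar> \<le> J" for n
    using I_bound[of "2 ^ n"] I_pow[of n] by (simp add: J_def abs_mult)
  then have "I 1 = 0"
  proof (rule_tac ccontr)
    assume "I 1 \<noteq> 0" and *: "\<And>n. 2 ^ n * \<bar>I 1\<bar> \<le> J"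
    obtain n where "J / \<bar>I 1\<bar> < 2 ^ n" using real_arch_pow[of 2 "J / \<bar>I 1\<bar>"] by auto
    with *[of n] \<open>I 1 \<noteq> 0\<close> show False by (simp add: divide_less_eq)
  qed
  have "\<rho> z * ln (norm (\<zeta> - z)) = \<rho> z * ln (norm \<zeta>) + f 1 z" for z
  proof (cases "\<rho> z = 0")
    case nz: False
    have "\<zeta> - z = \<zeta> * (1 - z / \<zeta>)" using False by (simp add: field_simps)
    moreover have "1 - z / \<zeta> \<noteq> 0" using small[OF nz] s by auto
    ultimately have "ln (norm (\<zeta> - z)) = ln (norm \<zeta>) + ln (norm (1 - z / \<zeta>))"
      using False by (simp add: norm_mult ln_mult)
    then show ?thesis by (simp add: f_def distrib_left)
  qed (simp add: f_def)
  then have "(\<integral>z. \<rho> z * ln (norm (\<zeta> - z)) \<partial>lborel) = (\<integral>z. \<rho> z * ln (norm \<zeta>) + f 1 z \<partial>lborel)"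
    by simp
  also have "\<dots> = (\<integral>z. \<rho> z * ln (norm \<zeta>) \<partial>lborel) + I 1"
    unfolding I_def using \<rho> int[of 1] by (intro Bochner_Integration.integral_add) auto
  finally show ?thesis using \<open>I 1 = 0\<close> by simp
qed

lemma plane_coordinates:
  assumes "DIM('a::euclidean_space) = 2"
  obtains \<phi> :: "complex \<Rightarrow> 'a::euclidean_space" where "linear \<phi>" "\<And>z. norm (\<phi> z) = norm z" "surj \<phi>" "distr lborel borel \<phi> = lborel"
proof -
  obtain b c :: 'a where bc: "Basis = {b, c}" "b \<noteq> c" using assms by (auto simp: card_2_iff)
  then have "b \<in> Basis" "c \<in> Basis" by auto
  then have orth: "b \<bullet> b = 1" "c \<bullet> c = 1" "b \<bullet> c = 0" using bc(2) by (auto simp: inner_Basis)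
  define \<phi> where "\<phi> z = Re z *\<^sub>R b + Im z *\<^sub>R c" for z
  have lin: "linear \<phi>" by (rule linearI) (auto simp: \<phi>_def algebra_simps)
  have norm: "norm (\<phi> z) = norm z" for z
    using orth by (simp add: \<phi>_def norm_eq_sqrt_inner inner_add_left inner_add_right inner_commute inner_complex_def)
  have "\<phi> (Complex (v \<bullet> b) (v \<bullet> c)) = v" for v
  proof -
    have "(\<Sum>k\<in>{b, c}. (v \<bullet> k) *\<^sub>R k) = v"
      unfolding bc(1)[symmetric] by (rule euclidean_representation)
    then show ?thesis using bc(2) by (simp add: \<phi>_def)
  qed
  then have surj: "surj \<phi>" by (rule surjI)
  have "bij_betw \<phi> Basis Basis"
    using bc by (auto simp: bij_betw_def inj_on_def Basis_complex_def \<phi>_def)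
  then show ?thesis
    using that[OF lin norm surj] lborel_distr_basis_isomorphism[OF lin] by blast
qed

lemma integral_lborel_reflect:
  fixes F :: "'a::euclidean_space \<Rightarrow> real"
  assumes [measurable]: "F \<in> borel_measurable borel"
  shows "(\<integral>u. F u \<partial>lborel) = (\<integral>z. F (x - z) \<partial>lborel)"
proof -
  have "(\<integral>u. F u \<partial>lborel) = (\<integral>u. F u \<partial>density (distr lborel borel (\<lambda>z. x + (- 1) *\<^sub>R z)) (\<lambda>_. 1))"
    by (subst lborel_affine[of "- 1" x]) (auto simp: one_ennreal_def)
  also have "\<dots> = (\<integral>z. F (x - z) \<partial>lborel)"
    by (simp add: density_1 integral_distr)
  finally show ?thesis .
qed

text \<open>Newton's theorem in the plane: outside its support, a radial charge of mass one has the same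
  logarithmic potential as a point charge at its centre.\<close>

lemma log_mean_value:
  fixes x v :: "'a::euclidean_space"
  assumes dim: "DIM('a) = 2" and \<eta>: "mollifier \<eta>" and a: "0 < a" "a \<le> dist x v"
  shows "(\<integral>u. ln (norm (u - v)) * scaled \<eta> a (x - u) \<partial>lborel) = ln (dist x v)"
proof -
  note [measurable] = measurable_scaled[OF \<eta>]
  obtain \<phi> :: "complex \<Rightarrow> 'a" where lin: "linear \<phi>" and norm: "\<And>z. norm (\<phi> z) = norm z"
    and surj: "surj \<phi>" and \<phi>: "distr lborel borel \<phi> = lborel"
    using plane_coordinates[OF dim] by metis
  have [measurable]: "\<phi> \<in> borel_measurable borel"
    using lin by (intro borel_measurable_continuous_onI linear_continuous_on) (simp add: linear_conv_bounded_linear)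
  obtain \<zeta> where \<zeta>: "\<phi> \<zeta> = x - v" using surj by (metis surjD)
  obtain c where c: "0 < c" "c < 1" "\<And>a x u. 0 < a \<Longrightarrow> scaled \<eta> a (x - u) \<noteq> 0 \<Longrightarrow> dist x u \<le> c * a"
    using mollifier_support[OF \<eta>] by metis
  have "has_bochner_integral (distr lborel borel \<phi>) (\<lambda>u. scaled \<eta> a (0 - u)) 1"
    unfolding \<phi> by (rule has_bochner_integral_scaled[OF \<eta> a(1)])
  then have one: "has_bochner_integral lborel (\<lambda>z. scaled \<eta> a (0 - \<phi> z)) 1"
    by (simp add: has_bochner_integral_iff integrable_distr_eq integral_distr)
  have even: "scaled \<eta> a (0 - \<phi> z) = scaled \<eta> a (\<phi> z)" for z
    by (rule scaled_radial[OF \<eta>]) simp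
  have "(\<integral>u. ln (norm (u - v)) * scaled \<eta> a (x - u) \<partial>lborel)
      = (\<integral>w. ln (norm (x - w - v)) * scaled \<eta> a (x - (x - w)) \<partial>lborel)"
    by (rule integral_lborel_reflect) measurable
  also have "\<dots> = (\<integral>w. scaled \<eta> a w * ln (norm (x - v - w)) \<partial>distr lborel borel \<phi>)"
    unfolding \<phi> by (simp add: algebra_simps)
  also have "\<dots> = (\<integral>z. scaled \<eta> a (\<phi> z) * ln (norm (x - v - \<phi> z)) \<partial>lborel)"
    by (rule integral_distr) measurable
  also have "\<dots> = (\<integral>z. scaled \<eta> a (\<phi> z) * ln (norm (\<zeta> - z)) \<partial>lborel)"
    by (simp add: \<zeta>[symmetric] norm linear_diff[OF lin, symmetric])
  also have "\<dots> = (\<integral>z. scaled \<eta> a (\<phi> z) \<partial>lborel) * ln (norm \<zeta>)"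
  proof (rule log_mean_value_complex)
    show "integrable lborel (\<lambda>z. scaled \<eta> a (\<phi> z))"
      using one unfolding even by (simp add: has_bochner_integral_iff)
    show "scaled \<eta> a (\<phi> z) = scaled \<eta> a (\<phi> w)" if "norm z = norm w" for z w
      using that by (intro scaled_radial[OF \<eta>]) (simp add: norm)
    show "norm z \<le> c * a" if "scaled \<eta> a (\<phi> z) \<noteq> 0" for z
      using c(3)[OF a(1), of "\<phi> z" 0] that norm[of z] by simp
    have "c * a < 1 * a" using c a by (intro mult_strict_right_mono) auto
    also have "1 * a \<le> norm \<zeta>" using a norm[of \<zeta>] by (simp add: \<zeta> dist_norm)
    finally show "c * a < norm \<zeta>" .
  qed
  also have "\<dots> = ln (dist x v)"
    using one norm[of \<zeta>] unfolding even by (simp add: has_bochner_integral_iff \<zeta> dist_norm)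
  finally show ?thesis .
qed

text \<open>Applying the mean value property to each of the two variables shows that smearing two points over
  disjoint discs does not change their logarithmic interaction.\<close>

lemma log_mean_value_pair:
  fixes x y :: "'a::euclidean_space"
  assumes dim: "DIM('a) = 2" and \<eta>: "mollifier \<eta>" and ab: "0 < a" "0 < b" "a + b \<le> dist x y"
  shows "has_bochner_integral (lborel \<Otimes>\<^sub>M lborel)
    (\<lambda>p. ln (norm (fst p - snd p)) * weight \<eta> a x b y p) (ln (dist x y))"
proof -
  note [measurable] = measurable_weight[OF \<eta>]
  let ?M = "lborel \<Otimes>\<^sub>M (lborel :: 'a measure)" and ?w = "weight \<eta> a x b y"
  let ?f = "\<lambda>p. ln (norm (fst p - snd p)) * ?w p"
  have w: "integrable ?M ?w" using has_bochner_integral_weight[OF \<eta> ab(1,2)] by (simp add: has_bochner_integral_iff)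
  obtain c where c: "0 < c" "c < 1" "\<And>a x u. 0 < a \<Longrightarrow> scaled \<eta> a (x - u) \<noteq> 0 \<Longrightarrow> dist x u \<le> c * a"
    using mollifier_support[OF \<eta>] by metis
  define D where "D = dist x y"
  have D: "0 < D" using ab unfolding D_def by linarith
  define L where "L = \<bar>ln ((1 - c) * D)\<bar> + \<bar>ln (2 * D)\<bar>"
  have bound: "\<bar>?f p\<bar> \<le> L * ?w p" for p
  proof (cases "?w p = 0")
    case False
    then have "dist x (fst p) \<le> c * a" "dist y (snd p) \<le> c * b"
      using c(3) ab by (auto simp: weight_def)
    moreover have "c * a + c * b \<le> c * D"
      using ab c by (simp add: D_def flip: distrib_left)
    moreover have "D \<le> dist x (fst p) + norm (fst p - snd p) + dist y (snd p)"
      using dist_triangle[of x y "fst p"] dist_triangle[of "fst p" y "snd p"]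
      by (simp add: D_def dist_norm norm_minus_commute)
    moreover have "norm (fst p - snd p) \<le> dist x (fst p) + D + dist y (snd p)"
      using dist_triangle[of "fst p" "snd p" x] dist_triangle[of x "snd p" y]
      by (simp add: D_def dist_norm norm_minus_commute)
    moreover have "c * D \<le> D" using c D by simp
    ultimately have "(1 - c) * D \<le> norm (fst p - snd p)" "norm (fst p - snd p) \<le> 2 * D"
      by (simp_all add: algebra_simps)
    moreover have "0 < (1 - c) * D" using c D by simp
    ultimately have "ln ((1 - c) * D) \<le> ln (norm (fst p - snd p))" "ln (norm (fst p - snd p)) \<le> ln (2 * D)"
      using D by (auto intro!: ln_mono)
    then have "\<bar>ln (norm (fst p - snd p))\<bar> \<le> L" unfolding L_def by linarith
    then show ?thesis
      using weight_nonneg[OF \<eta> ab(1,2), of x y p] by (simp add: abs_mult mult_right_mono)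
  qed simp
  have int: "integrable ?M ?f"
  proof (rule Bochner_Integration.integrable_bound)
    show "integrable ?M (\<lambda>p. L * ?w p)" using w by simp
    show "AE p in ?M. norm (?f p) \<le> norm (L * ?w p)"
      using order_trans[OF bound abs_ge_self] unfolding real_norm_def by (intro always_eventually allI)
  qed measurable
  have "integral\<^sup>L ?M ?f = (\<integral>v. \<integral>u. ?f (u, v) \<partial>lborel \<partial>lborel)"
    using lborel_pair.integral_snd[of "\<lambda>u v. ?f (u, v)"] int by (simp add: case_prod_beta')
  also have "\<dots> = (\<integral>v. ln (norm (v - x)) * scaled \<eta> b (y - v) \<partial>lborel)"
  proof (rule Bochner_Integration.integral_cong[OF refl])
    fix v
    have "(\<integral>u. ?f (u, v) \<partial>lborel) = (\<integral>u. ln (norm (u - v)) * scaled \<eta> a (x - u) \<partial>lborel) * scaled \<eta> b (y - v)"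
      by (simp add: weight_def flip: mult.assoc)
    also have "\<dots> = ln (norm (v - x)) * scaled \<eta> b (y - v)"
    proof (cases "scaled \<eta> b (y - v) = 0")
      case False
      then have "dist y v < b" using scaled_outside[OF \<eta> ab(2)] by (metis mem_ball)
      then have "a \<le> dist x v" using ab dist_triangle2[of x y v] by simp
      then show ?thesis using log_mean_value[OF dim \<eta> ab(1), of x v]
        by (simp add: dist_norm norm_minus_commute[of x v])
    qed simp
    finally show "(\<integral>u. ?f (u, v) \<partial>lborel) = ln (norm (v - x)) * scaled \<eta> b (y - v)" .
  qed
  also have "\<dots> = ln (dist y x)"
    using ab by (intro log_mean_value[OF dim \<eta>]) (auto simp: dist_commute)
  finally show ?thesis using int by (simp add: has_bochner_integral_iff dist_commute)
qed

section \<open>Second-order error of smearing in the plane\<close>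

lemma linear_le_if_Basis_le:
  fixes L :: "'a::euclidean_space \<Rightarrow> real"
  assumes "linear L" "\<And>v. v \<in> Basis \<Longrightarrow> \<bar>L v\<bar> \<le> B"
  shows "\<bar>L h\<bar> \<le> real DIM('a) * B * norm h"
proof -
  have "L h = (\<Sum>v\<in>Basis. (h \<bullet> v) * L v)"
    using linear_sum[OF assms(1), of "\<lambda>v. (h \<bullet> v) *\<^sub>R v" Basis]
    by (simp add: euclidean_representation linear_scale[OF assms(1)])
  also have "\<bar>\<dots>\<bar> \<le> (\<Sum>v\<in>Basis. \<bar>(h \<bullet> v) * L v\<bar>)" by (rule sum_abs)
  also have "\<dots> \<le> (\<Sum>v\<in>(Basis::'a set). norm h * B)"
    unfolding abs_mult using assms(2) Basis_le_norm by (intro sum_mono mult_mono) auto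
  finally show ?thesis by (simp add: mult_ac)
qed

text \<open>The mean value inequality is used twice: for the partial derivatives, which are therefore
  Lipschitz, and for \<open>f\<close> minus its linearization.\<close>

lemma C2_taylor:
  fixes f :: "'a::euclidean_space \<Rightarrow> real"
  assumes C2: "Ck_on 2 W f" and S: "convex S" "S \<subseteq> W"
    and B: "\<And>v w z. v \<in> Basis \<Longrightarrow> w \<in> Basis \<Longrightarrow> z \<in> S \<Longrightarrow> \<bar>iter_deriv [w, v] f z\<bar> \<le> B"
    and pq: "p \<in> S" "q \<in> S"
  shows "\<bar>f q - f p - frechet_derivative f (at p) (q - p)\<bar> \<le> (real DIM('a))\<^sup>2 * B * (norm (q - p))\<^sup>2"
proof -
  let ?n = "real DIM('a)" and ?D = "\<lambda>v z. frechet_derivative f (at z) v"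
  have B0: "0 \<le> B" using B[OF SOME_Basis SOME_Basis pq(1)] by linarith
  have diff: "iter_deriv vs f differentiable (at z)" if "set vs \<subseteq> Basis" "length vs < 2" "z \<in> S" for vs z
    using C2 that S(2) unfolding Ck_on_def by blast
  have f: "(f has_derivative frechet_derivative f (at z)) (at z)" if "z \<in> S" for z
    using diff[of "[]" z] that frechet_derivative_works by auto
  have Df: "(?D v has_derivative frechet_derivative (?D v) (at z)) (at z)" if "v \<in> Basis" "z \<in> S" for v z
    using diff[of "[v]" z] that frechet_derivative_works by auto
  have lip: "\<bar>?D v z - ?D v p\<bar> \<le> ?n * B * norm (z - p)" if v: "v \<in> Basis" and z: "z \<in> S" for v z
  proof -
    have "norm (?D v z - ?D v p) \<le> ?n * B * norm (z - p)"
    proof (rule differentiable_bound[OF S(1)])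
      show "(?D v has_derivative frechet_derivative (?D v) (at z)) (at z within S)" if "z \<in> S" for z
        using Df[OF v that] by (rule has_derivative_at_withinI)
      show "onorm (frechet_derivative (?D v) (at z)) \<le> ?n * B" if "z \<in> S" for z
      proof (rule onorm_le)
        fix h
        have "\<bar>frechet_derivative (?D v) (at z) h\<bar> \<le> ?n * B * norm h"
          using B[OF v _ that] by (intro linear_le_if_Basis_le has_derivative_linear[OF Df[OF v that]]) auto
        then show "norm (frechet_derivative (?D v) (at z) h) \<le> ?n * B * norm h" by simp
      qed
    qed (use z pq in auto)
    then show ?thesis by simp
  qed
  let ?r = "norm (q - p)"
  \<comment> \<open>On the smaller convex set the derivative of the remainder is itself of order \<open>?r\<close>.\<close>
  define T where "T = S \<inter> cball p ?r"
  have T: "convex T" "p \<in> T" "q \<in> T"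
    using S pq by (auto simp: T_def dist_norm norm_minus_commute intro: convex_Int)
  let ?G = "\<lambda>z. f z - frechet_derivative f (at p) z"
  have lin: "bounded_linear (frechet_derivative f (at p))"
    using f[OF pq(1)] by (rule has_derivative_bounded_linear)
  have "norm (?G q - ?G p) \<le> (?n * (?n * B * ?r)) * norm (q - p)"
  proof (rule differentiable_bound[OF T(1)])
    fix z assume z: "z \<in> T"
    then have zS: "z \<in> S" and zr: "norm (z - p) \<le> ?r" by (auto simp: T_def dist_norm norm_minus_commute)
    let ?H = "\<lambda>h. frechet_derivative f (at z) h - frechet_derivative f (at p) h"
    have H: "(?G has_derivative ?H) (at z)"
      by (intro has_derivative_diff f[OF zS] bounded_linear_imp_has_derivative lin)
    then show "(?G has_derivative ?H) (at z within T)" by (rule has_derivative_at_withinI)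
    show "onorm ?H \<le> ?n * (?n * B * ?r)"
    proof (rule onorm_le)
      fix h
      have "\<bar>?H h\<bar> \<le> ?n * (?n * B * ?r) * norm h"
      proof (rule linear_le_if_Basis_le[OF has_derivative_linear[OF H]])
        fix v :: 'a assume "v \<in> Basis"
        then have "\<bar>?H v\<bar> \<le> ?n * B * norm (z - p)" using lip zS by blast
        also have "\<dots> \<le> ?n * B * ?r" using zr B0 by (intro mult_left_mono) auto
        finally show "\<bar>?H v\<bar> \<le> ?n * B * ?r" .
      qed
      then show "norm (?H h) \<le> ?n * (?n * B * ?r) * norm h" by simp
    qed
  qed (use T in auto)
  moreover have "?G q - ?G p = f q - f p - frechet_derivative f (at p) (q - p)"
    using linear_diff[OF bounded_linear.linear[OF lin]] by simp
  ultimately show ?thesis by (simp add: power2_eq_square mult_ac)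
qed

text \<open>First-order terms cancel, because the weight is symmetric about \<open>(x, y)\<close>.\<close>

lemma integral_odd_weight:
  fixes x y :: "'a::euclidean_space" and L :: "'a \<times> 'a \<Rightarrow> real"
  assumes \<eta>: "mollifier \<eta>" and L: "linear L"
  shows "(\<integral>p. L (p - (x, y)) * weight \<eta> a x b y p \<partial>(lborel \<Otimes>\<^sub>M lborel)) = 0"
proof -
  note [measurable] = measurable_weight[OF \<eta>, unfolded lborel_prod]
  have [measurable]: "L \<in> borel_measurable borel"
    using L by (intro borel_measurable_continuous_onI linear_continuous_on) (simp add: linear_conv_bounded_linear)
  let ?f = "\<lambda>p. L (p - (x, y)) * weight \<eta> a x b y p"
  have sym: "?f ((2 *\<^sub>R x, 2 *\<^sub>R y) - p) = - ?f p" for p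
  proof -
    have 1: "(2 *\<^sub>R x, 2 *\<^sub>R y) - p - (x, y) = - (p - (x, y))"
      by (cases p) (simp add: scaleR_2)
    have 2: "scaled \<eta> c (z - (2 *\<^sub>R z - u)) = scaled \<eta> c (z - u)" for c z u
      by (rule scaled_radial[OF \<eta>]) (simp add: scaleR_2 norm_minus_commute)
    show ?thesis
      unfolding 1 linear_neg[OF L] by (simp add: weight_def 2)
  qed
  have "(\<integral>p. ?f p \<partial>lborel) = (\<integral>p. ?f ((2 *\<^sub>R x, 2 *\<^sub>R y) - p) \<partial>lborel)"
    by (rule integral_lborel_reflect) measurable
  also have "\<dots> = - (\<integral>p. ?f p \<partial>lborel)" unfolding sym by simp
  finally show ?thesis unfolding lborel_prod by simp
qed

text \<open>The logarithmic part of the kernel is not affected by smearing over disjoint discs, and for the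
  regular part \<open>g\<close> the constant and linear Taylor terms are averaged exactly. What is left is
  quadratic in the scales, which is small enough to be summed over all pairs.\<close>

lemma cov_near_kernel:
  fixes x y :: "'a::euclidean_space"
  assumes lc: "log_correlated_kernel U g" and dim: "DIM('a) = 2" and C2: "Ck_on 2 (U \<times> U) g"
    and \<eta>: "mollifier \<eta>" and ab: "0 < a" "0 < b" "a + b \<le> dist x y"
    and sub: "ball x a \<subseteq> U" "ball y b \<subseteq> U"
    and A: "\<And>v w z. v \<in> Basis \<Longrightarrow> w \<in> Basis \<Longrightarrow> z \<in> ball x a \<times> ball y b \<Longrightarrow> \<bar>iter_deriv [w, v] g z\<bar> \<le> A"
  shows "\<bar>cov U g \<eta> a x b y - log_kernel U g x y\<bar> \<le> (real DIM('a \<times> 'a))\<^sup>2 * A * (a\<^sup>2 + b\<^sup>2)"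
proof -
  note [measurable] = measurable_weight[OF \<eta>]
  let ?M = "lborel \<Otimes>\<^sub>M (lborel :: 'a measure)" and ?w = "weight \<eta> a x b y"
  let ?K = "\<lambda>p. log_kernel U g (fst p) (snd p)" and ?l = "\<lambda>p. ln (norm (fst p - snd p)) :: real"
  let ?S = "ball x a \<times> ball y b"
  obtain B where B: "\<And>x. \<bar>\<eta> x\<bar> \<le> B" using test_function_bounded[OF mollifier_test_function[OF \<eta>]] by metis
  note w = has_bochner_integral_weight[OF \<eta> ab(1,2), of x y, unfolded has_bochner_integral_iff]
  note l = log_mean_value_pair[OF dim \<eta> ab, unfolded has_bochner_integral_iff]
  note K = cov_integrable_and_bound(1)[OF lc \<eta> ab(1,2) B, of x y]
  have xy: "x \<noteq> y" "x \<in> U" "y \<in> U" using ab sub by auto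
  have K_eq: "?K p = - ?l p + g p" if "p \<in> ?S" for p
  proof (cases p)
    case (Pair u v)
    then have "u \<in> U" "v \<in> U" using that sub by auto
    moreover have "u \<noteq> v"
      using that ab dist_triangle2[of x y u] by (auto simp: Pair)
    ultimately show ?thesis by (simp add: Pair log_kernel_def ln_div)
  qed
  have "(x, y) \<in> ?S" using ab by auto
  then have K0: "log_kernel U g x y = - ln (dist x y) + g (x, y)"
    using K_eq[of "(x, y)"] by (simp add: dist_norm)
  define L where "L = frechet_derivative g (at (x, y))"
  have "g differentiable (at (x, y))"
  proof -
    have "iter_deriv [] g differentiable (at (x, y))"
      using C2 xy(2,3) unfolding Ck_on_def by (metis SigmaI empty_set empty_subsetI list.size(3) zero_less_numeral)
    then show ?thesis by simp
  qed
  then have L: "linear L" unfolding L_def by (rule linear_frechet_derivative)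
  let ?e = "(real DIM('a \<times> 'a))\<^sup>2 * A * (a\<^sup>2 + b\<^sup>2)"
  have A0: "0 \<le> A" using A[OF SOME_Basis SOME_Basis \<open>(x, y) \<in> ?S\<close>] by linarith
  let ?r = "\<lambda>p. ?K p * ?w p + ?l p * ?w p - g (x, y) * ?w p"
  have r: "\<bar>?r p - L (p - (x, y)) * ?w p\<bar> \<le> ?e * ?w p" for p
  proof (cases "p \<in> ?S")
    case False
    then have "?w p = 0" using weight_outside[OF \<eta> ab(1,2)] by (auto simp: mem_Times_iff)
    then show ?thesis by simp
  next
    case True
    obtain u v where p: "p = (u, v)" by fastforce
    have "\<bar>g p - g (x, y) - L (p - (x, y))\<bar> \<le> (real DIM('a \<times> 'a))\<^sup>2 * A * (norm (p - (x, y)))\<^sup>2"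
      unfolding L_def
      by (rule C2_taylor[OF C2, of ?S]) (use A True sub ab in \<open>auto intro: convex_Times\<close>)
    also have "\<dots> \<le> ?e"
    proof -
      have "norm (u - x) \<le> a" "norm (v - y) \<le> b" using True by (auto simp: p dist_norm norm_minus_commute)
      then have "(norm (u - x))\<^sup>2 + (norm (v - y))\<^sup>2 \<le> a\<^sup>2 + b\<^sup>2"
        by (intro add_mono power_mono) auto
      then have "(norm (p - (x, y)))\<^sup>2 \<le> a\<^sup>2 + b\<^sup>2" by (simp add: p norm_Pair)
      then show ?thesis using A0 by (intro mult_left_mono) auto
    qed
    finally have "\<bar>g p - g (x, y) - L (p - (x, y))\<bar> * ?w p \<le> ?e * ?w p"
      using weight_nonneg[OF \<eta> ab(1,2)] by (intro mult_right_mono) auto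
    moreover have "?r p - L (p - (x, y)) * ?w p = (g p - g (x, y) - L (p - (x, y))) * ?w p"
      unfolding K_eq[OF True] by (simp add: algebra_simps)
    ultimately show ?thesis using weight_nonneg[OF \<eta> ab(1,2), of x y p] by (simp add: abs_mult)
  qed
  have int_r: "integrable ?M ?r" using K l w by auto
  have int_d: "integrable ?M (\<lambda>p. ?r p - L (p - (x, y)) * ?w p)"
  proof (rule Bochner_Integration.integrable_bound)
    show "integrable ?M (\<lambda>p. ?e * ?w p)" using w by simp
    show "AE p in ?M. norm (?r p - L (p - (x, y)) * ?w p) \<le> norm (?e * ?w p)"
      using order_trans[OF r abs_ge_self] unfolding real_norm_def by (intro always_eventually allI)
    have "L \<in> borel_measurable borel"
      using L by (intro borel_measurable_continuous_onI linear_continuous_on) (simp add: linear_conv_bounded_linear)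
    then have "(\<lambda>p. L (p - (x, y))) \<in> borel_measurable ?M"
      unfolding lborel_prod by measurable
    then show "(\<lambda>p. ?r p - L (p - (x, y)) * ?w p) \<in> borel_measurable ?M"
      using borel_measurable_integrable[OF int_r] measurable_weight[OF \<eta>, of a x b y]
      by (intro borel_measurable_diff[of ?r] borel_measurable_times)
  qed
  have "integrable ?M (\<lambda>p. ?r p - (?r p - L (p - (x, y)) * ?w p))"
    using int_r int_d by (rule Bochner_Integration.integrable_diff)
  then have int_L: "integrable ?M (\<lambda>p. L (p - (x, y)) * ?w p)" by simp
  have "integral\<^sup>L ?M ?r = cov U g \<eta> a x b y + ln (dist x y) - g (x, y)"
    using K l w by (simp add: cov_def)
  then have "cov U g \<eta> a x b y - log_kernel U g x y = integral\<^sup>L ?M ?r"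
    using K0 by simp
  also have "\<dots> = (\<integral>p. ?r p - L (p - (x, y)) * ?w p \<partial>?M)"
    using int_r int_L integral_odd_weight[OF \<eta> L, of x y a b]
    by (subst Bochner_Integration.integral_diff) auto
  finally have eq: "cov U g \<eta> a x b y - log_kernel U g x y = (\<integral>p. ?r p - L (p - (x, y)) * ?w p \<partial>?M)" .
  have "\<bar>\<integral>p. ?r p - L (p - (x, y)) * ?w p \<partial>?M\<bar> \<le> (\<integral>p. \<bar>?r p - L (p - (x, y)) * ?w p\<bar> \<partial>?M)"
    by (rule integral_abs_bound)
  also have "\<dots> \<le> (\<integral>p. ?e * ?w p \<partial>?M)"
    using int_d w r by (intro integral_mono) auto
  also have "\<dots> = ?e" using w by simp
  finally show ?thesis unfolding eq .
qed

section \<open>Nearest neighbours and the energy inequality\<close>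

definition nn_dist :: "nat \<Rightarrow> (nat \<Rightarrow> 'a::metric_space) \<Rightarrow> nat \<Rightarrow> real" where
  "nn_dist N x j = Min ((\<lambda>k. dist (x j) (x k)) ` ({1..N} - {j}))"

lemma nn_log_sum_eq: "nn_log_sum N x = (\<Sum>j = 1..N. ln (1 / (1/2 * nn_dist N x j)))"
  by (simp add: nn_log_sum_def nn_dist_def)

lemma nn_dist_le: "k \<in> {1..N} \<Longrightarrow> k \<noteq> j \<Longrightarrow> nn_dist N x j \<le> dist (x j) (x k)"
  unfolding nn_dist_def by (intro Min_le) auto

lemma nn_dist_attained:
  assumes "configuration K N q x" "j \<in> {1..N}"
  obtains k where "k \<in> {1..N}" "k \<noteq> j" "nn_dist N x j = dist (x j) (x k)"
proof -
  have "(if j = 1 then 2 else 1) \<in> {1..N} - {j}" using assms by (auto simp: configuration_def)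
  then have "(\<lambda>k. dist (x j) (x k)) ` ({1..N} - {j}) \<noteq> {}" by blast
  then have "nn_dist N x j \<in> (\<lambda>k. dist (x j) (x k)) ` ({1..N} - {j})"
    unfolding nn_dist_def by (intro Min_in) auto
  then show ?thesis using that by blast
qed

lemma nn_dist_pos:
  assumes "configuration K N q x" "j \<in> {1..N}"
  shows "0 < nn_dist N x j"
proof -
  obtain k where k: "k \<in> {1..N}" "k \<noteq> j" "nn_dist N x j = dist (x j) (x k)"
    using nn_dist_attained[OF assms] by metis
  have "inj_on x {1..N}" using assms(1) by (simp add: configuration_def)
  then have "x j \<noteq> x k" using inj_onD[of x "{1..N}" j k] assms(2) k by blast
  then show ?thesis by (simp add: k(3))
qed

lemma cov_commute:
  assumes lc: "log_correlated_kernel U g" and \<eta>: "mollifier \<eta>" and ab: "0 < a" "0 < b"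
  shows "cov U g \<eta> a x b y = cov U g \<eta> b y a x"
proof -
  obtain B where B: "\<And>x. \<bar>\<eta> x\<bar> \<le> B" using test_function_bounded[OF mollifier_test_function[OF \<eta>]] by metis
  let ?f = "\<lambda>p. log_kernel U g (fst p) (snd p) * weight \<eta> a x b y p"
  have sym: "log_kernel U g v u = log_kernel U g u v" for u v
    using lc unfolding log_correlated_kernel_def covariance_kernel_def by blast
  have "cov U g \<eta> a x b y = (\<integral>(u, v). ?f (v, u) \<partial>(lborel \<Otimes>\<^sub>M lborel))"
    unfolding cov_def
    using cov_integrable_and_bound(1)[OF lc \<eta> ab B, of x y]
    by (intro lborel_pair.integral_product_swap[symmetric]) auto
  also have "(\<lambda>(u, v). ?f (v, u)) = (\<lambda>p. log_kernel U g (fst p) (snd p) * weight \<eta> b y a x p)"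
    using sym by (auto simp: weight_def fun_eq_iff)
  finally show ?thesis by (simp add: cov_def)
qed

text \<open>The diagonal carries the self-energies, since charges square to one, and each pair occurs twice.\<close>

lemma quadratic_form_eq_pair_sum:
  assumes sym: "\<And>j k. j \<in> {1..N} \<Longrightarrow> k \<in> {1..N} \<Longrightarrow> c j k = c k j"
    and q: "\<And>j. j \<in> {1..N} \<Longrightarrow> q j * q j = 1"
  shows "(\<Sum>j = 1..N. \<Sum>k = 1..N. q j * q k * c j k) = (\<Sum>j = 1..N. c j j) + 2 * pair_sum N q c"
proof -
  let ?I = "{1..N}" and ?F = "\<lambda>(j, k). q j * q k * c j k"
  let ?L = "{(j, k). 1 \<le> j \<and> j < k \<and> k \<le> N}" and ?D = "(\<lambda>j. (j, j)) ` ?I"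
  have sub: "?L \<subseteq> ?I \<times> ?I" by auto
  then have fin: "finite ?L" by (rule finite_subset) simp
  have split: "?I \<times> ?I = ?D \<union> (?L \<union> prod.swap ` ?L)"
    by (auto simp: image_iff)
  have "(\<Sum>j = 1..N. \<Sum>k = 1..N. q j * q k * c j k) = sum ?F (?I \<times> ?I)"
    by (simp add: sum.cartesian_product)
  also have "\<dots> = sum ?F ?D + (sum ?F ?L + sum ?F (prod.swap ` ?L))"
    unfolding split using fin by (subst sum.union_disjoint; (subst sum.union_disjoint)?; auto)
  also have "sum ?F ?D = (\<Sum>j = 1..N. c j j)"
    using q by (subst sum.reindex) (auto simp: inj_on_def)
  also have "sum ?F (prod.swap ` ?L) = sum ?F ?L"
    using sub sym by (subst sum.reindex) (auto intro!: sum.cong simp: mult_ac)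
  finally show ?thesis by (simp add: pair_sum_def)
qed

lemma pair_sum_diff_le:
  assumes q: "\<And>j. j \<in> {1..N} \<Longrightarrow> \<bar>q j\<bar> = 1"
    and e: "\<And>j k. j \<in> {1..N} \<Longrightarrow> k \<in> {1..N} \<Longrightarrow> 0 \<le> e j k"
    and d: "\<And>j k. j \<in> {1..N} \<Longrightarrow> k \<in> {1..N} \<Longrightarrow> j \<noteq> k \<Longrightarrow> \<bar>c j k - c' j k\<bar> \<le> e j k"
  shows "\<bar>pair_sum N q c - pair_sum N q c'\<bar> \<le> (\<Sum>j = 1..N. \<Sum>k = 1..N. e j k)"
proof -
  let ?L = "{(j, k). 1 \<le> j \<and> j < k \<and> k \<le> N}"
  have sub: "?L \<subseteq> {1..N} \<times> {1..N}" by auto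
  have diff: "pair_sum N q c - pair_sum N q c' = (\<Sum>(j, k)\<in>?L. q j * q k * (c j k - c' j k))"
    unfolding pair_sum_def
    by (subst sum_subtractf[symmetric]) (auto intro!: sum.cong simp: algebra_simps)
  have "\<bar>pair_sum N q c - pair_sum N q c'\<bar> \<le> (\<Sum>p\<in>?L. \<bar>case p of (j, k) \<Rightarrow> q j * q k * (c j k - c' j k)\<bar>)"
    unfolding diff by (rule sum_abs)
  also have "\<dots> \<le> (\<Sum>(j, k)\<in>?L. e j k)"
    using q d by (intro sum_mono) (auto simp: abs_mult)
  also have "\<dots> \<le> (\<Sum>(j, k)\<in>{1..N} \<times> {1..N}. e j k)"
    using e sub by (intro sum_mono2) auto
  finally show ?thesis by (simp add: sum.cartesian_product)
qed

text \<open>The energy inequality. The quadratic form of the smeared charges is non-negative, so minus the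
  interaction of the pairs is at most half the sum of the self-energies. The numbers \<open>e j k\<close> allow
  for the difference between smeared and actual interactions.\<close>

lemma neg_pair_sum_le:
  fixes x :: "nat \<Rightarrow> 'a::euclidean_space"
  assumes lc: "log_correlated_kernel U g" and \<eta>: "mollifier \<eta>"
    and conf: "configuration K N q x"
    and a: "\<And>j. j \<in> {1..N} \<Longrightarrow> 0 < a j"
    and e: "\<And>j k. j \<in> {1..N} \<Longrightarrow> k \<in> {1..N} \<Longrightarrow> 0 \<le> e j k"
    and near: "\<And>j k. j \<in> {1..N} \<Longrightarrow> k \<in> {1..N} \<Longrightarrow> j \<noteq> k \<Longrightarrow>
      \<bar>c j k - cov U g \<eta> (a j) (x j) (a k) (x k)\<bar> \<le> e j k"
    and self: "\<And>j. j \<in> {1..N} \<Longrightarrow>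
      cov U g \<eta> (a j) (x j) (a j) (x j) \<le> ln (1 / (1/2 * nn_dist N x j)) + V"
  shows "- pair_sum N q c \<le> 1/2 * nn_log_sum N x + V / 2 * real N + (\<Sum>j = 1..N. \<Sum>k = 1..N. e j k)"
proof -
  let ?c = "\<lambda>j k. cov U g \<eta> (a j) (x j) (a k) (x k)"
  have q: "q j = -1 \<or> q j = 1" if "j \<in> {1..N}" for j
    using conf that by (auto simp: configuration_def)
  have qq: "q j * q j = 1" "\<bar>q j\<bar> = 1" if "j \<in> {1..N}" for j
    using q[OF that] by auto
  have "0 \<le> (\<Sum>j = 1..N. \<Sum>k = 1..N. q j * q k * ?c j k)"
    using a by (intro cov_quadratic_form_nonneg[OF lc \<eta>]) auto
  also have "\<dots> = (\<Sum>j = 1..N. ?c j j) + 2 * pair_sum N q ?c"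
    using cov_commute[OF lc \<eta> a a] by (intro quadratic_form_eq_pair_sum qq)
  also have "(\<Sum>j = 1..N. ?c j j) \<le> (\<Sum>j = 1..N. ln (1 / (1/2 * nn_dist N x j)) + V)"
    by (intro sum_mono self)
  also have "\<dots> = nn_log_sum N x + V * real N"
    by (simp add: nn_log_sum_eq sum.distrib mult.commute)
  finally have "- pair_sum N q ?c \<le> 1/2 * nn_log_sum N x + V / 2 * real N" by simp
  moreover have "\<bar>pair_sum N q c - pair_sum N q ?c\<bar> \<le> (\<Sum>j = 1..N. \<Sum>k = 1..N. e j k)"
    by (intro pair_sum_diff_le qq e near)
  ultimately show ?thesis by linarith
qed

lemma compact_thickening:
  fixes K U :: "'a::euclidean_space set"
  assumes "compact K" "open U" "K \<subseteq> U"
  obtains \<delta> L where "0 < \<delta>" "compact L" "L \<subseteq> U" "\<And>x. x \<in> K \<Longrightarrow> cball x \<delta> \<subseteq> L"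
proof -
  obtain \<delta> where \<delta>: "0 < \<delta>" "(\<Union>x\<in>K. cball x \<delta>) \<subseteq> U"
    using compact_subset_open_imp_cball_epsilon_subset[OF assms] by metis
  have "(\<Union>x\<in>K. cball x \<delta>) = {x + y |x y. x \<in> K \<and> y \<in> cball 0 \<delta>}"
  proof (intro set_eqI iffI)
    fix z assume "z \<in> (\<Union>x\<in>K. cball x \<delta>)"
    then obtain x where "x \<in> K" "dist x z \<le> \<delta>" by auto
    then show "z \<in> {x + y |x y. x \<in> K \<and> y \<in> cball 0 \<delta>}"
      by (intro CollectI exI[of _ x] exI[of _ "z - x"]) (auto simp: dist_norm norm_minus_commute)
  next
    fix z assume "z \<in> {x + y |x y. x \<in> K \<and> y \<in> cball 0 \<delta>}"
    then obtain x y where "x \<in> K" "norm y \<le> \<delta>" "z = x + y" by auto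
    then show "z \<in> (\<Union>x\<in>K. cball x \<delta>)" by (intro UN_I[of x]) (auto simp: dist_norm)
  qed
  then have "compact (\<Union>x\<in>K. cball x \<delta>)"
    using compact_sums[OF assms(1) compact_cball[of 0 \<delta>]] by simp
  then show ?thesis using that[of \<delta> "\<Union>x\<in>K. cball x \<delta>"] \<delta> by blast
qed

lemma continuous_bounded_on_compact:
  fixes f :: "'a::topological_space \<Rightarrow> real"
  assumes "compact L" "continuous_on L f"
  obtains B where "0 \<le> B" "\<And>z. z \<in> L \<Longrightarrow> \<bar>f z\<bar> \<le> B"
proof -
  obtain b where b: "\<And>y. y \<in> f ` L \<Longrightarrow> norm y \<le> b"
    using compact_imp_bounded[OF compact_continuous_image[OF assms(2,1)]] unfolding bounded_iff by blast
  show ?thesis using b by (intro that[of "max b 0"]) force+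
qed

text \<open>Compares areas: the discs are disjoint and lie in \<open>W\<close>.\<close>

lemma sum_squares_disjoint_balls_le:
  fixes x :: "'i \<Rightarrow> 'a::euclidean_space"
  assumes "DIM('a) = 2" "finite I" "bounded W" "open W"
    and r: "\<And>i. i \<in> I \<Longrightarrow> 0 \<le> r i" and sub: "\<And>i. i \<in> I \<Longrightarrow> ball (x i) (r i) \<subseteq> W"
    and disj: "\<And>i j. i \<in> I \<Longrightarrow> j \<in> I \<Longrightarrow> i \<noteq> j \<Longrightarrow> r i + r j \<le> dist (x i) (x j)"
  shows "pi * (\<Sum>i\<in>I. (r i)\<^sup>2) \<le> measure lborel W"
proof -
  have W: "W \<in> fmeasurable lborel"
    using assms(3,4) emeasure_bounded_finite[of W] by (auto simp: fmeasurable_def)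
  have "pi * (\<Sum>i\<in>I. (r i)\<^sup>2) = (\<Sum>i\<in>I. measure lborel (ball (x i) (r i)))"
    using r assms(1) by (simp add: content_ball unit_ball_vol_2 sum_distrib_left)
  also have "\<dots> = measure lborel (\<Union>i\<in>I. ball (x i) (r i))"
  proof (rule measure_UNION'[symmetric])
    show "pairwise (\<lambda>i j. disjnt (ball (x i) (r i)) (ball (x j) (r j))) I"
      unfolding pairwise_def disjnt_def using disj disjoint_ballI by blast
  qed (use assms(2) emeasure_bounded_finite[OF bounded_ball] in \<open>auto simp: fmeasurable_def\<close>)
  also have "\<dots> \<le> measure lborel W"
    using sub W by (intro measure_mono_fmeasurable) (auto intro!: borel_open open_UN)
  finally show ?thesis .
qed

lemma bounded_diameter:
  fixes K :: "'a::metric_space set"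
  assumes "bounded K"
  obtains D where "0 < D" "\<And>x y. x \<in> K \<Longrightarrow> y \<in> K \<Longrightarrow> dist x y \<le> D"
proof -
  obtain d where "\<And>x y. x \<in> K \<Longrightarrow> y \<in> K \<Longrightarrow> dist x y \<le> d"
    using assms unfolding bounded_two_points by blast
  then have "x \<in> K \<Longrightarrow> y \<in> K \<Longrightarrow> dist x y \<le> max d 1" for x y by (meson max.coboundedI1)
  then show ?thesis using that[of "max d 1"] by auto
qed

lemma iter_deriv_bounded_on_compact:
  fixes f :: "'a::euclidean_space \<Rightarrow> real"
  assumes "Ck_on 2 W f" "compact L" "L \<subseteq> W"
  obtains A where "0 \<le> A" "\<And>v w z. v \<in> Basis \<Longrightarrow> w \<in> Basis \<Longrightarrow> z \<in> L \<Longrightarrow> \<bar>iter_deriv [w, v] f z\<bar> \<le> A"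
proof -
  have "continuous_on L (\<lambda>z. \<Sum>v\<in>Basis. \<Sum>w\<in>Basis. \<bar>iter_deriv [w, v] f z\<bar>)"
  proof (intro continuous_intros)
    fix v w :: 'a assume "v \<in> Basis" "w \<in> Basis"
    then have "set [w, v] \<subseteq> Basis \<and> length [w, v] \<le> 2" by simp
    then have "continuous_on W (iter_deriv [w, v] f)" using assms(1) unfolding Ck_on_def by blast
    then show "continuous_on L (iter_deriv [w, v] f)" using assms(3) continuous_on_subset by blast
  qed
  then obtain A where A: "0 \<le> A" "\<And>z. z \<in> L \<Longrightarrow> \<bar>\<Sum>v\<in>Basis. \<Sum>w\<in>Basis. \<bar>iter_deriv [w, v] f z\<bar>\<bar> \<le> A"
    using continuous_bounded_on_compact[OF assms(2)] by blast
  have "\<bar>iter_deriv [w, v] f z\<bar> \<le> A" if "v \<in> Basis" "w \<in> Basis" "z \<in> L" for v w z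
  proof -
    have "\<bar>iter_deriv [w, v] f z\<bar> \<le> (\<Sum>w\<in>Basis. \<bar>iter_deriv [w, v] f z\<bar>)"
      using that by (intro member_le_sum) auto
    also have "\<dots> \<le> (\<Sum>v\<in>Basis. \<Sum>w\<in>Basis. \<bar>iter_deriv [w, v] f z\<bar>)"
      using that by (intro member_le_sum[of v Basis "\<lambda>v. \<Sum>w\<in>Basis. \<bar>iter_deriv [w, v] f z\<bar>"] sum_nonneg) auto
    finally show ?thesis using A(2)[OF that(3)] by linarith
  qed
  then show ?thesis using that A(1) by blast
qed

text \<open>The self-energy at a scale that is not smaller than a fixed multiple of the nearest neighbour
  distance \<open>m\<close>.\<close>

lemma cov_diagonal_le:
  fixes x :: "'a::euclidean_space"
  assumes lc: "log_correlated_kernel U g" and \<eta>: "mollifier \<eta>" and B: "\<And>x. \<bar>\<eta> x\<bar> \<le> B"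
    and L: "L \<subseteq> U" "cball x \<delta> \<subseteq> L" and a: "0 < a" "a \<le> \<delta>"
    and G: "\<And>z. z \<in> L \<times> L \<Longrightarrow> \<bar>g z\<bar> \<le> G"
    and m: "0 < m" "0 < \<kappa>" "\<kappa> * (m / 2) \<le> a"
  shows "cov U g \<eta> a x a x \<le> ln (1 / (1/2 * m)) + (\<bar>ln \<kappa>\<bar> + (ln 4 + G + 2 * (B * log_pole_mass TYPE('a))))"
proof -
  have "ball x a \<subseteq> L" using L(2) a(2) by auto
  then have "\<bar>cov U g \<eta> a x a x + ln (max (dist x x) (max a a))\<bar> \<le> ln 4 + G + 2 * (B * log_pole_mass TYPE('a))"
    using L(1) G by (intro cov_estimate[OF lc \<eta> a(1) a(1) B]) blast+
  moreover have "ln (\<kappa> * (m / 2)) \<le> ln a" using m by (intro ln_mono) auto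
  moreover have "ln (\<kappa> * (m / 2)) = ln \<kappa> + ln (m / 2)" using m by (subst ln_mult) auto
  moreover have "ln (1 / (1/2 * m)) = - ln (m / 2)" using m by (simp add: ln_div)
  ultimately show ?thesis using a by (simp add: max_def)
qed

text \<open>The points are smeared over discs with radii proportional to the nearest neighbour distances. A
  pair costs \<open>O((r j)\<^sup>2 + (r k)\<^sup>2)\<close>; summed over the partner this gives \<open>N\<close> times the sum of the
  squared radii, which is bounded by an area.\<close>

lemma energy_bound_kernel:
  fixes U K :: "'a::euclidean_space set"
  assumes lc: "log_correlated_kernel U g" and K: "compact K" "K \<subseteq> U"
    and dim: "DIM('a) = 2" and C2: "Ck_on 2 (U \<times> U) g"
  shows "\<exists>C>0. \<forall>N q x. configuration K N q x \<longrightarrow>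
      - pair_sum N q (\<lambda>j k. log_kernel U g (x j) (x k)) \<le> 1/2 * nn_log_sum N x + C * real N"
proof -
  have U: "open U" "bounded U" "continuous_on (U \<times> U) g"
    using lc by (auto simp: log_correlated_kernel_def)
  obtain \<eta> :: "'a \<Rightarrow> real" where \<eta>: "mollifier \<eta>" using mollifier_exists by blast
  obtain B where B: "0 < B" "\<And>x. \<bar>\<eta> x\<bar> \<le> B" using test_function_bounded[OF mollifier_test_function[OF \<eta>]] by metis
  obtain \<delta> L where L: "0 < \<delta>" "compact L" "L \<subseteq> U" "\<And>x. x \<in> K \<Longrightarrow> cball x \<delta> \<subseteq> L"
    using compact_thickening[OF K(1) U(1) K(2)] by metis
  have LL: "compact (L \<times> L)" "L \<times> L \<subseteq> U \<times> U" using L by (auto intro: compact_Times)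
  obtain G where G: "0 \<le> G" "\<And>z. z \<in> L \<times> L \<Longrightarrow> \<bar>g z\<bar> \<le> G"
    using continuous_bounded_on_compact[OF LL(1) continuous_on_subset[OF U(3) LL(2)]] by metis
  obtain A where A: "0 \<le> A"
    "\<And>v w z. v \<in> Basis \<Longrightarrow> w \<in> Basis \<Longrightarrow> z \<in> L \<times> L \<Longrightarrow> \<bar>iter_deriv [w, v] g z\<bar> \<le> A"
    using iter_deriv_bounded_on_compact[OF C2 LL] by metis
  obtain D where D: "0 < D" "\<And>x y. x \<in> K \<Longrightarrow> y \<in> K \<Longrightarrow> dist x y \<le> D"
    using bounded_diameter[OF compact_imp_bounded[OF K(1)]] by metis
  \<comment> \<open>The factor makes every \<open>\<kappa> * nn_dist N x j / 2\<close> at most \<open>\<delta>\<close>, so that the balls stay in \<open>L\<close>;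
    it changes the self-energies only by a constant.\<close>
  define \<kappa> where "\<kappa> = min 1 (2 * \<delta> / D)"
  have \<kappa>: "0 < \<kappa>" "\<kappa> \<le> 1" "\<kappa> * (D / 2) \<le> \<delta>"
    using L(1) D(1) by (auto simp: \<kappa>_def min_def field_simps)
  define V where "V = \<bar>ln \<kappa>\<bar> + (ln 4 + G + 2 * (B * log_pole_mass TYPE('a)))"
  define F where "F = (real DIM('a \<times> 'a))\<^sup>2 * A"
  define C where "C = 1 + V / 2 + 2 * F * (measure lborel U / pi)"
  have V: "0 \<le> V" using G(1) B(1) by (simp add: V_def)
  have F: "0 \<le> F" using A(1) by (simp add: F_def)
  have C: "0 < C" using V F by (simp add: C_def add_pos_nonneg)
  have "- pair_sum N q (\<lambda>j k. log_kernel U g (x j) (x k)) \<le> 1/2 * nn_log_sum N x + C * real N"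
    if conf: "configuration K N q x" for N q and x :: "nat \<Rightarrow> 'a"
  proof -
    define r where "r j = \<kappa> * (nn_dist N x j / 2)" for j
    have xK: "x j \<in> K" if "j \<in> {1..N}" for j using conf that by (auto simp: configuration_def)
    have r_pos: "0 < r j" if "j \<in> {1..N}" for j
      using nn_dist_pos[OF conf that] \<kappa> by (simp add: r_def)
    have r_half: "r j \<le> nn_dist N x j / 2" if "j \<in> {1..N}" for j
      using nn_dist_pos[OF conf that] \<kappa> by (simp add: r_def mult_left_le_one_le)
    have r_le: "r j \<le> \<delta>" if j: "j \<in> {1..N}" for j
    proof -
      obtain k where "k \<in> {1..N}" "nn_dist N x j = dist (x j) (x k)"
        using nn_dist_attained[OF conf j] by metis
      then have "nn_dist N x j \<le> D" using D(2) xK j by simp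
      then have "r j \<le> \<kappa> * (D / 2)" unfolding r_def using \<kappa> by (intro mult_left_mono) auto
      with \<kappa>(3) show ?thesis by simp
    qed
    have disj: "r j + r k \<le> dist (x j) (x k)" if "j \<in> {1..N}" "k \<in> {1..N}" "j \<noteq> k" for j k
      using r_half[OF that(1)] r_half[OF that(2)] nn_dist_le[of k N j x] nn_dist_le[of j N k x] that
      by (simp add: dist_commute)
    have sub: "ball (x j) (r j) \<subseteq> L" if "j \<in> {1..N}" for j
      using L(4)[OF xK[OF that]] r_le[OF that] by auto
    have "- pair_sum N q (\<lambda>j k. log_kernel U g (x j) (x k))
        \<le> 1/2 * nn_log_sum N x + V / 2 * real N + (\<Sum>j = 1..N. \<Sum>k = 1..N. F * ((r j)\<^sup>2 + (r k)\<^sup>2))"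
    proof (rule neg_pair_sum_le[OF lc \<eta> conf, of r])
      show "\<bar>log_kernel U g (x j) (x k) - cov U g \<eta> (r j) (x j) (r k) (x k)\<bar> \<le> F * ((r j)\<^sup>2 + (r k)\<^sup>2)"
        if "j \<in> {1..N}" "k \<in> {1..N}" "j \<noteq> k" for j k
        unfolding F_def abs_minus_commute[of "log_kernel U g (x j) (x k)"]
        using sub[OF that(1)] sub[OF that(2)] L(3) A(2)
        by (intro cov_near_kernel[OF lc dim C2 \<eta> r_pos r_pos disj] that) blast+
      show "cov U g \<eta> (r j) (x j) (r j) (x j) \<le> ln (1 / (1/2 * nn_dist N x j)) + V" if "j \<in> {1..N}" for j
        unfolding V_def
        by (rule cov_diagonal_le[OF lc \<eta> B(2) L(3) L(4)[OF xK[OF that]] r_pos[OF that] r_le[OF that] G(2)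
              nn_dist_pos[OF conf that] \<kappa>(1)]) (auto simp: r_def)
    qed (use F r_pos in auto)
    also have "(\<Sum>j = 1..N. \<Sum>k = 1..N. F * ((r j)\<^sup>2 + (r k)\<^sup>2)) = 2 * F * real N * (\<Sum>j = 1..N. (r j)\<^sup>2)"
      by (simp add: sum.distrib distrib_left algebra_simps flip: sum_distrib_left)
    also have "\<dots> \<le> 2 * F * real N * (measure lborel U / pi)"
    proof -
      have "pi * (\<Sum>j = 1..N. (r j)\<^sup>2) \<le> measure lborel U"
        using r_pos sub L(3) disj
        by (intro sum_squares_disjoint_balls_le[OF dim _ U(2,1)]) (auto intro: less_imp_le)
      then have "(\<Sum>j = 1..N. (r j)\<^sup>2) \<le> measure lborel U / pi" by (simp add: pos_le_divide_eq mult.commute)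
      then show ?thesis using F by (intro mult_left_mono) auto
    qed
    finally have "- pair_sum N q (\<lambda>j k. log_kernel U g (x j) (x k))
        \<le> 1/2 * nn_log_sum N x + (V / 2 + 2 * F * (measure lborel U / pi)) * real N"
      by (simp add: algebra_simps)
    then show ?thesis unfolding C_def by (simp add: algebra_simps)
  qed
  with C show ?thesis by blast
qed

lemma conv_approx_covariance:
  fixes x y :: "'a::euclidean_space"
  assumes \<eta>: "mollifier \<eta>" "0 < \<epsilon>" and X: "log_correlated_field U g M X" and xy: "x \<in> U" "y \<in> U"
  shows "(\<integral>\<omega>. conv_approx U \<eta> X \<epsilon> x \<omega> * conv_approx U \<eta> X \<epsilon> y \<omega> \<partial>M) = cov U g \<eta> \<epsilon> x \<epsilon> y"
proof -
  let ?f = "\<lambda>z u. scaled \<eta> \<epsilon> (z - u)"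
  have "(\<integral>\<omega>. conv_approx U \<eta> X \<epsilon> x \<omega> * conv_approx U \<eta> X \<epsilon> y \<omega> \<partial>M) = (\<integral>\<omega>. X (?f x) \<omega> * X (?f y) \<omega> \<partial>M)"
    using xy by (simp add: conv_approx_def)
  also have "\<dots> = (\<integral>(u, v). log_kernel U g u v * ?f x u * ?f y v \<partial>(lborel \<Otimes>\<^sub>M lborel))"
    using X test_function_scaled[OF \<eta>] unfolding log_correlated_field_def by blast
  finally show ?thesis by (simp add: cov_def weight_def case_prod_beta' mult.assoc)
qed

text \<open>For small \<open>\<epsilon>\<close>, the points are smeared at the larger of \<open>\<epsilon>\<close> and a multiple of the nearest
  neighbour distance. For a pair of distinct points this enlargement is invisible in the cut-off
  \<open>max (dist (x j) (x k)) \<epsilon>\<close>, so each pair costs \<open>O(1)\<close>. For large \<open>\<epsilon>\<close> the balls may leave the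
  domain, but then all covariances are bounded by the integral of the absolute value of the kernel.\<close>

lemma energy_bound_smeared:
  fixes U K :: "'a::euclidean_space set"
  assumes lc: "log_correlated_kernel U g" and K: "compact K" "K \<subseteq> U" and \<eta>: "mollifier \<eta>"
  shows "\<exists>C>0. \<forall>N q x \<epsilon>. configuration K N q x \<and> \<epsilon> > 0 \<longrightarrow>
      - pair_sum N q (\<lambda>j k. cov U g \<eta> \<epsilon> (x j) \<epsilon> (x k)) \<le> 1/2 * nn_log_sum N x + C * (real N)\<^sup>2"
proof -
  have U: "open U" "bounded U" "continuous_on (U \<times> U) g"
    using lc by (auto simp: log_correlated_kernel_def)
  obtain B where B: "0 < B" "\<And>x. \<bar>\<eta> x\<bar> \<le> B" using test_function_bounded[OF mollifier_test_function[OF \<eta>]] by metis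
  obtain \<delta> L where L: "0 < \<delta>" "compact L" "L \<subseteq> U" "\<And>x. x \<in> K \<Longrightarrow> cball x \<delta> \<subseteq> L"
    using compact_thickening[OF K(1) U(1) K(2)] by metis
  have LL: "compact (L \<times> L)" "L \<times> L \<subseteq> U \<times> U" using L by (auto intro: compact_Times)
  obtain G where G: "0 \<le> G" "\<And>z. z \<in> L \<times> L \<Longrightarrow> \<bar>g z\<bar> \<le> G"
    using continuous_bounded_on_compact[OF LL(1) continuous_on_subset[OF U(3) LL(2)]] by metis
  obtain D where D: "0 < D" "\<And>x y. x \<in> K \<Longrightarrow> y \<in> K \<Longrightarrow> dist x y \<le> D"
    using bounded_diameter[OF compact_imp_bounded[OF K(1)]] by metis
  \<comment> \<open>The factor makes every \<open>\<kappa> * nn_dist N x j / 2\<close> at most \<open>\<delta>\<close>, so that the balls stay in \<open>L\<close>;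
    it changes the self-energies only by a constant.\<close>
  define \<kappa> where "\<kappa> = min 1 (2 * \<delta> / D)"
  have \<kappa>: "0 < \<kappa>" "\<kappa> \<le> 1" "\<kappa> * (D / 2) \<le> \<delta>"
    using L(1) D(1) by (auto simp: \<kappa>_def min_def field_simps)
  define E where "E = ln 4 + G + 2 * (B * log_pole_mass TYPE('a))"
  define V where "V = \<bar>ln \<kappa>\<bar> + E"
  define J where "J = (\<integral>p. \<bar>log_kernel U g (fst p) (snd p)\<bar> \<partial>(lborel \<Otimes>\<^sub>M lborel))"
  define H where "H = B / \<delta> ^ DIM('a) * (B / \<delta> ^ DIM('a)) * J"
  define C where "C = 1 + V / 2 + 2 * E + H + \<bar>ln (D / 2)\<bar>"
  have E: "0 \<le> E" using G(1) B(1) by (simp add: E_def)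
  have J: "0 \<le> J" by (simp add: J_def)
  have H: "0 \<le> H" using J B(1) L(1) by (simp add: H_def)
  have V: "0 \<le> V" using E by (simp add: V_def)
  have C: "0 < C" using V E H by (simp add: C_def add_pos_nonneg)
  have "- pair_sum N q (\<lambda>j k. cov U g \<eta> \<epsilon> (x j) \<epsilon> (x k)) \<le> 1/2 * nn_log_sum N x + C * (real N)\<^sup>2"
    if conf: "configuration K N q x" and \<epsilon>: "0 < \<epsilon>" for N q \<epsilon> and x :: "nat \<Rightarrow> 'a"
  proof -
    have xK: "x j \<in> K" if "j \<in> {1..N}" for j using conf that by (auto simp: configuration_def)
    have "1 \<le> real N" using conf by (simp add: configuration_def)
    then have N: "real N \<le> (real N)\<^sup>2" "0 \<le> (real N)\<^sup>2" by (auto simp: power2_eq_square)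
    have m_le: "nn_dist N x j \<le> D" if j: "j \<in> {1..N}" for j
    proof -
      obtain k where "k \<in> {1..N}" "nn_dist N x j = dist (x j) (x k)"
        using nn_dist_attained[OF conf j] by metis
      then show ?thesis using D(2) xK j by simp
    qed
    show ?thesis
    proof (cases "\<epsilon> \<le> \<delta>")
      case True
      define a where "a j = max \<epsilon> (\<kappa> * (nn_dist N x j / 2))" for j
      have a_pos: "0 < a j" for j using \<epsilon> by (simp add: a_def max_def)
      have a_le: "a j \<le> \<delta>" if j: "j \<in> {1..N}" for j
      proof -
        have "\<kappa> * (nn_dist N x j / 2) \<le> \<kappa> * (D / 2)" using m_le[OF j] \<kappa> by (intro mult_left_mono) auto
        with \<kappa>(3) True show ?thesis by (simp add: a_def)
      qed
      have sub: "ball (x j) b \<subseteq> L" if "j \<in> {1..N}" "b \<le> \<delta>" for j b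
        using L(4)[OF xK[OF that(1)]] that(2) by auto
      have est: "\<bar>cov U g \<eta> b (x j) c (x k) + ln (max (dist (x j) (x k)) (max b c))\<bar> \<le> E"
        if "j \<in> {1..N}" "k \<in> {1..N}" "0 < b" "b \<le> \<delta>" "0 < c" "c \<le> \<delta>" for j k b c
        unfolding E_def using sub[OF that(1,4)] sub[OF that(2,6)] L(3) G(2)
        by (intro cov_estimate[OF lc \<eta> that(3,5) B(2)]) blast+
      have "- pair_sum N q (\<lambda>j k. cov U g \<eta> \<epsilon> (x j) \<epsilon> (x k))
        \<le> 1/2 * nn_log_sum N x + V / 2 * real N + (\<Sum>j = 1..N. \<Sum>k = 1..N. 2 * E)"
      proof (rule neg_pair_sum_le[OF lc \<eta> conf, of a])
        fix j k assume jk: "j \<in> {1..N}" "k \<in> {1..N}" "j \<noteq> k"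
        have half: "\<kappa> * (nn_dist N x i / 2) \<le> nn_dist N x i" if "i \<in> {1..N}" for i
        proof -
          have "\<kappa> * (nn_dist N x i / 2) \<le> 1 * (nn_dist N x i / 2)"
            using nn_dist_pos[OF conf that] \<kappa> by (intro mult_right_mono) auto
          then show ?thesis using nn_dist_pos[OF conf that] by simp
        qed
        have "\<kappa> * (nn_dist N x j / 2) \<le> dist (x j) (x k)" "\<kappa> * (nn_dist N x k / 2) \<le> dist (x j) (x k)"
          using half[OF jk(1)] half[OF jk(2)] nn_dist_le[of k N j x] nn_dist_le[of j N k x] jk
          by (auto simp: dist_commute)
        then have "max (dist (x j) (x k)) (max (a j) (a k)) = max (dist (x j) (x k)) (max \<epsilon> \<epsilon>)"
          unfolding a_def by linarith
        then show "\<bar>cov U g \<eta> \<epsilon> (x j) \<epsilon> (x k) - cov U g \<eta> (a j) (x j) (a k) (x k)\<bar> \<le> 2 * E"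
          using est[OF jk(1,2) \<epsilon> True \<epsilon> True] est[OF jk(1,2) a_pos[of j] a_le[OF jk(1)] a_pos[of k] a_le[OF jk(2)]]
          by (simp only: abs_le_iff) linarith
      next
        fix j assume j: "j \<in> {1..N}"
        show "cov U g \<eta> (a j) (x j) (a j) (x j) \<le> ln (1 / (1/2 * nn_dist N x j)) + V"
          unfolding V_def E_def
          by (rule cov_diagonal_le[OF lc \<eta> B(2) L(3) L(4)[OF xK[OF j]] a_pos a_le[OF j] G(2)
                nn_dist_pos[OF conf j] \<kappa>(1)]) (auto simp: a_def)
      qed (use E a_pos in auto)
      also have "(\<Sum>j = 1..N. \<Sum>k = 1..N. 2 * E) = 2 * E * (real N)\<^sup>2" by (simp add: power2_eq_square)
      also have "1/2 * nn_log_sum N x + V / 2 * real N + 2 * E * (real N)\<^sup>2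
          \<le> 1/2 * nn_log_sum N x + C * (real N)\<^sup>2"
      proof -
        have "V / 2 * real N \<le> V / 2 * (real N)\<^sup>2" using N V by (intro mult_left_mono) auto
        moreover have "(V / 2 + 2 * E) * (real N)\<^sup>2 \<le> C * (real N)\<^sup>2"
          using H by (intro mult_right_mono) (auto simp: C_def)
        ultimately show ?thesis by (simp add: distrib_right)
      qed
      finally show ?thesis .
    next
      case False
      have "\<bar>cov U g \<eta> \<epsilon> (x j) \<epsilon> (x k)\<bar> \<le> H" for j k
      proof -
        have "\<bar>cov U g \<eta> \<epsilon> (x j) \<epsilon> (x k)\<bar> \<le> B / \<epsilon> ^ DIM('a) * (B / \<epsilon> ^ DIM('a)) * J"
          unfolding J_def by (rule cov_integrable_and_bound(2)[OF lc \<eta> \<epsilon> \<epsilon> B(2)])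
        also have "\<dots> \<le> H"
          unfolding H_def using False L(1) B(1) J
          by (intro mult_right_mono mult_mono divide_left_mono power_mono) auto
        finally show ?thesis .
      qed
      moreover have q_abs: "\<bar>q j\<bar> = 1" if "j \<in> {1..N}" for j
      proof -
        have "q j \<in> {-1, 1}" using conf that unfolding configuration_def by blast
        then show ?thesis by auto
      qed
      ultimately have "\<bar>pair_sum N q (\<lambda>j k. cov U g \<eta> \<epsilon> (x j) \<epsilon> (x k)) - pair_sum N q (\<lambda>j k. 0)\<bar>
          \<le> (\<Sum>j = 1..N. \<Sum>k = 1..N. H)"
        using q_abs H by (intro pair_sum_diff_le) auto
      moreover have "pair_sum N q (\<lambda>j k. 0) = 0" by (simp add: pair_sum_def)
      ultimately have "- pair_sum N q (\<lambda>j k. cov U g \<eta> \<epsilon> (x j) \<epsilon> (x k)) \<le> H * (real N)\<^sup>2"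
        by (simp add: power2_eq_square mult_ac abs_le_iff)
      moreover have "- (\<bar>ln (D / 2)\<bar> * real N) \<le> nn_log_sum N x"
      proof -
        have "- \<bar>ln (D / 2)\<bar> \<le> ln (1 / (1/2 * nn_dist N x j))" if j: "j \<in> {1..N}" for j
        proof -
          have "ln (nn_dist N x j / 2) \<le> ln (D / 2)"
            using m_le[OF j] nn_dist_pos[OF conf j] by (intro ln_mono) auto
          moreover have "ln (1 / (1/2 * nn_dist N x j)) = - ln (nn_dist N x j / 2)"
            using nn_dist_pos[OF conf j] by (simp add: ln_div)
          ultimately show ?thesis by linarith
        qed
        then have "(\<Sum>j = 1..N. - \<bar>ln (D / 2)\<bar>) \<le> nn_log_sum N x"
          unfolding nn_log_sum_eq by (intro sum_mono)
        then show ?thesis by (simp add: mult.commute)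
      qed
      moreover have "\<bar>ln (D / 2)\<bar> * real N \<le> \<bar>ln (D / 2)\<bar> * (real N)\<^sup>2" using N by (intro mult_left_mono) auto
      moreover have "(H + \<bar>ln (D / 2)\<bar>) * (real N)\<^sup>2 \<le> C * (real N)\<^sup>2"
        using V E by (intro mult_right_mono) (auto simp: C_def)
      moreover have "0 \<le> \<bar>ln (D / 2)\<bar> * (real N)\<^sup>2" by simp
      ultimately show ?thesis unfolding distrib_right by linarith
    qed
  qed
  with C show ?thesis by blast
qed

theorem proposition3p6:
  fixes U K :: "'a::euclidean_space set" and g :: "'a \<times> 'a \<Rightarrow> real"
  assumes "log_correlated_kernel U g"
    and "compact K" and "K \<subseteq> U"
  shows "(DIM('a) = 2 \<and> Ck_on 2 (U \<times> U) g \<longrightarrow>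
           (\<exists>C>0. \<forall>N q x. configuration K N q x \<longrightarrow>
              - pair_sum N q (\<lambda>j k. log_kernel U g (x j) (x k))
                \<le> 1/2 * nn_log_sum N x + C * real N))
       \<and> (\<forall>\<eta>. mollifier \<eta> \<longrightarrow>
           (\<exists>C>0. \<forall>(M :: 'w measure) X. log_correlated_field U g M X \<longrightarrow>
              (\<forall>N q x \<epsilon>. configuration K N q x \<and> \<epsilon> > 0 \<longrightarrow>
                 - pair_sum N q (\<lambda>j k. \<integral>\<omega>. conv_approx U \<eta> X \<epsilon> (x j) \<omega> * conv_approx U \<eta> X \<epsilon> (x k) \<omega> \<partial>M)
                   \<le> 1/2 * nn_log_sum N x + C * (real N)\<^sup>2)))"
proof (intro conjI impI allI)
  assume "DIM('a) = 2 \<and> Ck_on 2 (U \<times> U) g"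
  then show "\<exists>C>0. \<forall>N q x. configuration K N q x \<longrightarrow>
      - pair_sum N q (\<lambda>j k. log_kernel U g (x j) (x k)) \<le> 1/2 * nn_log_sum N x + C * real N"
    using energy_bound_kernel[OF assms] by blast
next
  fix \<eta> :: "'a \<Rightarrow> real"
  assume \<eta>: "mollifier \<eta>"
  obtain C where C: "C > 0" "\<And>N q x \<epsilon>. configuration K N q x \<Longrightarrow> \<epsilon> > 0 \<Longrightarrow>
      - pair_sum N q (\<lambda>j k. cov U g \<eta> \<epsilon> (x j) \<epsilon> (x k)) \<le> 1/2 * nn_log_sum N x + C * (real N)\<^sup>2"
    using energy_bound_smeared[OF assms \<eta>] by metis
  have "- pair_sum N q (\<lambda>j k. \<integral>\<omega>. conv_approx U \<eta> X \<epsilon> (x j) \<omega> * conv_approx U \<eta> X \<epsilon> (x k) \<omega> \<partial>M)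
      \<le> 1/2 * nn_log_sum N x + C * (real N)\<^sup>2"
    if X: "log_correlated_field U g M X" and conf: "configuration K N q x" and \<epsilon>: "\<epsilon> > 0"
    for M :: "'w measure" and X N q x \<epsilon>
  proof -
    have "x j \<in> U" if "1 \<le> j" "j \<le> N" for j
      using conf assms(3) that by (auto simp: configuration_def)
    then have "pair_sum N q (\<lambda>j k. \<integral>\<omega>. conv_approx U \<eta> X \<epsilon> (x j) \<omega> * conv_approx U \<eta> X \<epsilon> (x k) \<omega> \<partial>M)
        = pair_sum N q (\<lambda>j k. cov U g \<eta> \<epsilon> (x j) \<epsilon> (x k))"
      unfolding pair_sum_def by (intro sum.cong) (auto simp: conv_approx_covariance[OF \<eta> \<epsilon> X])
    with C(2)[OF conf \<epsilon>] show ?thesis by simp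
  qed
  with C(1) show "\<exists>C>0. \<forall>(M :: 'w measure) X. log_correlated_field U g M X \<longrightarrow>
              (\<forall>N q x \<epsilon>. configuration K N q x \<and> \<epsilon> > 0 \<longrightarrow>
                 - pair_sum N q (\<lambda>j k. \<integral>\<omega>. conv_approx U \<eta> X \<epsilon> (x j) \<omega> * conv_approx U \<eta> X \<epsilon> (x k) \<omega> \<partial>M)
                   \<le> 1/2 * nn_log_sum N x + C * (real N)\<^sup>2)"
    by blast
qed

end
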